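(* Let $g(u)=\operatorname{dist}(u,\mathbb{Z})$ for $u\in\mathbb{R}$, let $b=2$, and let $\lambda\in(0,1)$ with $2\lambda>1$. Put $\gamma:=\frac{1}{2\lambda}<1$, and suppose that the infinite Bernoulli convolution with parameter $\gamma$ has a square-integrable density with respect to Lebesgue measure on $\mathbb{R}$. Then the graph $\{(x,W_{\lambda,2}(x)):x\in[0,1)\}\subset\mathbb{R}^2$ of the function $W_{\lambda,2}:[0,1)\to\mathbb{R}$, $W_{\lambda,2}(x)=\sum_{n=0}^\infty\lambda^n g(2^n x)$, has Hausdorff dimension $$D=2+\frac{\log\lambda}{\log 2}.$$
   Context: $\operatorname{dist}(u,\mathbb{Z})$ denotes the distance from $u$ to the nearest integer. The infinite Bernoulli convolution with parameter $\gamma\in(0,1)$ is the distribution of the random variable $\Theta=\sum_{n=1}^\infty\gamma^n Z_n$, where the $Z_n$ are independent random variables with $P(Z_n=1)=P(Z_n=-1)=\frac12$. *)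

theory Defs
  imports "HOL-Probability.Probability"
begin

subsection \<open>Hausdorff dimension\<close>

text \<open>
  The convention is \<open>0\<^sup>0 = 1\<close>, except that the empty set always has gauge 0, so that the
  0-dimensional measure is the counting measure. (Note that \<open>0 powr 0 = 0\<close>.)
\<close>

definition hausdorff_gauge :: "real \<Rightarrow> 'a::metric_space set \<Rightarrow> ennreal" where
  "hausdorff_gauge s U =
     (if U = {} then 0 else if s = 0 then 1 else ennreal (diameter U powr s))"

text \<open>
  Boundedness of the covering sets is required separately because \<^const>\<open>diameter\<close> is
  meaningful only for bounded sets. Finite covers are included, since sets may be empty.
\<close>

definition hausdorff_premeasure :: "real \<Rightarrow> real \<Rightarrow> 'a::metric_space set \<Rightarrow> ennreal" where
  "hausdorff_premeasure s \<delta> A =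
     Inf {(\<Sum>i. hausdorff_gauge s (U i)) | U :: nat \<Rightarrow> 'a set.
            A \<subseteq> (\<Union>i. U i) \<and> (\<forall>i. bounded (U i) \<and> diameter (U i) \<le> \<delta>)}"

definition hausdorff_measure :: "real \<Rightarrow> 'a::metric_space set \<Rightarrow> ennreal" where
  "hausdorff_measure s A = (SUP \<delta>\<in>{0<..}. hausdorff_premeasure s \<delta> A)"

definition hausdorff_dim :: "'a::metric_space set \<Rightarrow> ereal" where
  "hausdorff_dim A = Inf {ereal s | s. 0 \<le> s \<and> hausdorff_measure s A = 0}"


subsection \<open>The infinite Bernoulli convolution\<close>

definition fair_sign :: "real measure" where
  "fair_sign = distr (measure_pmf (pmf_of_set {-1, 1})) borel (\<lambda>z. z)"

text \<open>
  The law of \<open>\<Sum>n\<ge>1. \<gamma>^n Z\<^sub>n\<close>, realised on the product space of sequences of signs;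
  coordinate \<open>n\<close> of \<open>\<omega>\<close> plays the role of \<open>Z\<close> with index \<open>n + 1\<close>.
\<close>

definition bernoulli_convolution :: "real \<Rightarrow> real measure" where
  "bernoulli_convolution \<gamma> =
     distr (Pi\<^sub>M (UNIV :: nat set) (\<lambda>_. fair_sign)) borel (\<lambda>\<omega>. \<Sum>n. \<gamma> ^ Suc n * \<omega> n)"

definition has_square_integrable_density :: "real measure \<Rightarrow> bool" where
  "has_square_integrable_density \<mu> \<longleftrightarrow>
     (\<exists>f :: real \<Rightarrow> real. f \<in> borel_measurable borel \<and> (\<forall>x. 0 \<le> f x) \<and>
        \<mu> = density lborel (\<lambda>x. ennreal (f x)) \<and> integrable lborel (\<lambda>x. (f x)\<^sup>2))"

lemma sets_fair_sign [simp, measurable_cong]: "sets fair_sign = sets borel"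
  by (simp add: fair_sign_def)

lemma (in prob_space) distr_eq_fair_sign:
  fixes X :: "'a \<Rightarrow> real"
  assumes [measurable]: "random_variable borel X"
    and "prob {\<omega> \<in> space M. X \<omega> = 1} = 1/2"
    and "prob {\<omega> \<in> space M. X \<omega> = -1} = 1/2"
  shows "distr M borel X = fair_sign"
proof (rule measure_eqI)
  fix A assume "A \<in> sets (distr M borel X)"
  then have A [measurable]: "A \<in> sets borel" by simp
  have "prob {\<omega> \<in> space M. X \<omega> = 1 \<or> X \<omega> = -1}
      = prob ({\<omega> \<in> space M. X \<omega> = 1} \<union> {\<omega> \<in> space M. X \<omega> = -1})"
    by (rule arg_cong[where f = prob]) auto
  also have "\<dots> = 1"
    by (subst finite_measure_Union) (use assms in auto)
  finally have ae: "AE \<omega> in M. X \<omega> = 1 \<or> X \<omega> = -1"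
    using AE_prob_1[of "{\<omega> \<in> space M. X \<omega> = 1 \<or> X \<omega> = -1}"] by (auto elim: eventually_mono)
  have "prob {\<omega> \<in> space M. X \<omega> \<in> A}
      = prob ({\<omega> \<in> space M. X \<omega> = 1 \<and> 1 \<in> A} \<union> {\<omega> \<in> space M. X \<omega> = -1 \<and> -1 \<in> A})"
    using ae by (intro finite_measure_eq_AE) auto
  also have "\<dots> = prob {\<omega> \<in> space M. X \<omega> = 1 \<and> 1 \<in> A}
                  + prob {\<omega> \<in> space M. X \<omega> = -1 \<and> -1 \<in> A}"
    by (rule finite_measure_Union) auto
  also have "\<dots> = (indicator A 1 + indicator A (-1)) / 2"
    using assms by (auto simp: indicator_def)
  also have "\<dots> = measure (measure_pmf (pmf_of_set {-1, 1})) A"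
    by (auto simp: measure_pmf_of_set indicator_def card_insert_if)
  finally show "emeasure (distr M borel X) A = emeasure fair_sign A"
    by (auto simp: fair_sign_def emeasure_distr emeasure_eq_measure measure_pmf.emeasure_eq_measure
        vimage_def Int_def conj_commute)
qed (simp add: fair_sign_def)

text \<open>The measure does not depend on the choice of the variables \<open>Z\<^sub>n\<close>.\<close>

lemma (in prob_space) distr_eq_bernoulli_convolution:
  fixes Z :: "nat \<Rightarrow> 'a \<Rightarrow> real"
  assumes indep: "indep_vars (\<lambda>_. borel) Z UNIV"
    and one: "\<And>n. prob {\<omega> \<in> space M. Z n \<omega> = 1} = 1/2"
    and minus_one: "\<And>n. prob {\<omega> \<in> space M. Z n \<omega> = -1} = 1/2"
  shows "distr M borel (\<lambda>\<omega>. \<Sum>n. \<gamma> ^ Suc n * Z n \<omega>) = bernoulli_convolution \<gamma>"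
proof -
  have [measurable]: "random_variable borel (Z n)" for n
    using indep by (auto simp: indep_vars_def)
  have "distr M (Pi\<^sub>M UNIV (\<lambda>_. borel)) (\<lambda>\<omega>. \<lambda>n\<in>UNIV. Z n \<omega>)
      = Pi\<^sub>M UNIV (\<lambda>n. distr M borel (Z n))"
    using indep by (subst (asm) indep_vars_iff_distr_eq_PiM) auto
  also have "\<dots> = Pi\<^sub>M UNIV (\<lambda>_. fair_sign)"
    by (simp add: distr_eq_fair_sign one minus_one)
  finally have law: "Pi\<^sub>M UNIV (\<lambda>_. fair_sign)
      = distr M (Pi\<^sub>M UNIV (\<lambda>_. borel)) (\<lambda>\<omega>. \<lambda>n\<in>UNIV. Z n \<omega>)" ..
  show ?thesis
    unfolding bernoulli_convolution_def law
    by (subst distr_distr) (measurable, simp add: comp_def)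
qed


subsection \<open>The Takagi-type functions\<close>

definition W :: "real \<Rightarrow> nat \<Rightarrow> real \<Rightarrow> real" where
  "W lam b x = (\<Sum>n. lam ^ n * infdist (real b ^ n * x) \<int>)"

end

theory Submission
  imports Defs
begin

text \<open>
  Write \<open>W (x) = g (x) + \<lambda> W (2x)\<close> and \<open>h\<^sub>\<theta> (x) = W (x) + \<theta> x\<close>. On the dyadic interval \<open>[k/2\<^sup>n, (k+1)/2\<^sup>n)\<close> the
  first \<open>n\<close> summands of \<open>W\<close> are affine, so that \<open>W\<close> is, up to a constant, the rescaled copy \<open>\<lambda>\<^sup>n h\<^sub>\<theta>\<close> of
  \<open>W\<close> with \<open>\<theta> = \<gamma> e\<^sub>n + \<gamma>\<^sup>2 e\<^sub>n\<^sub>-\<^sub>1 + \<dots> + \<gamma>\<^sup>n e\<^sub>1\<close>, where \<open>e\<^sub>i = \<plusminus>1\<close> encodes the \<open>i\<close>-th binary digit of the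
  interval. The upper bound on the dimension follows by counting boxes.

  For the lower bound consider \<open>m\<^sub>n (x)\<close>, the measure of the \<open>y\<close> in the dyadic interval of \<open>x\<close> with
  \<open>\<bar>W (x) - W (y)\<bar> \<le> 2\<^sup>-\<^sup>n\<close>. It equals \<open>2\<^sup>-\<^sup>n\<close> times the measure of the \<open>y\<close> in \<open>[0, 1)\<close> with
  \<open>\<bar>h\<^sub>\<theta> (x') - h\<^sub>\<theta> (y)\<bar> \<le> \<gamma>\<^sup>n\<close>, where \<open>x'\<close> is the fractional part of \<open>2\<^sup>n x\<close>. If \<open>\<theta>\<close> were distributed by Lebesgue
  measure on a bounded interval, the expectation of the latter would be \<open>O (n \<gamma>\<^sup>n)\<close> by Fubini, since
  \<open>h\<^sub>\<theta> (x') - h\<^sub>\<theta> (y)\<close> is affine in \<open>\<theta>\<close> with slope \<open>x' - y\<close>. Up to an error \<open>O (\<gamma>\<^sup>n)\<close>, the actual \<open>\<theta>\<close> is distributed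
  by the Bernoulli convolution, and its square-integrable density \<open>f\<close> permits a change of measure
  through \<open>f \<le> c + f\<^sup>2 / c\<close>. Hence for \<open>s < D\<close> the set where \<open>m\<^sub>n > 2\<^sup>-\<^sup>n\<^sup>s\<close> has exponentially small measure, and
  the Borel-Cantelli argument and the mass distribution principle apply.
\<close>

subsection \<open>Self-similarity over dyadic intervals\<close>

lemma infdist_Ints_le: "infdist x \<int> \<le> 1" for x :: real
  by (rule infdist_le2[of "of_int (round x)"])
     (use of_int_round_abs_le[of x] in \<open>auto simp: dist_real_def abs_minus_commute\<close>)

lemma Ints_nonempty: "(\<int> :: real set) \<noteq> {}"
  using Ints_0 by blast

lemma infdist_Ints_add_of_nat: "infdist (x + of_nat m) \<int> = infdist x \<int>" for x :: real
proof (rule antisym)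
  \<comment> \<open>One inequality for all integer shifts suffices: the reverse one is the shift by
    \<open>- m\<close>.\<close>
  have le: "infdist (x + of_int m) \<int> \<le> infdist x \<int>" for x :: real and m :: int
    unfolding infdist_notempty[OF Ints_nonempty] infdist_notempty[OF Ints_nonempty, of x]
  proof (rule cINF_greatest)
    fix a :: real assume a: "a \<in> \<int>"
    show "(INF a\<in>\<int>. dist (x + of_int m) a) \<le> dist x a"
      by (rule cINF_lower2[of _ _ "a + of_int m"]) (use a in \<open>auto simp: dist_real_def intro!: bdd_belowI2[of _ 0]\<close>)
  qed (auto intro: Ints_0)
  show "infdist (x + of_nat m) \<int> \<le> infdist x \<int>"
    using le[of x "int m"] by simp
  show "infdist x \<int> \<le> infdist (x + of_nat m) \<int>"
    using le[of "x + of_nat m" "- int m"] by simp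
qed

lemma infdist_Ints_unit_interval:
  fixes x :: real
  assumes "0 \<le> x" "x \<le> 1"
  shows "infdist x \<int> = min x (1 - x)"
proof (rule antisym)
  show "infdist x \<int> \<le> min x (1 - x)"
    using infdist_le[of 0 \<int> x] infdist_le[of 1 \<int> x] assms by (auto simp: dist_real_def)
  show "min x (1 - x) \<le> infdist x \<int>"
    unfolding infdist_notempty[OF Ints_nonempty]
  proof (rule cINF_greatest)
    fix a :: real assume "a \<in> \<int>"
    then obtain k where k: "a = of_int k" by (auto elim: Ints_cases)
    have "k \<le> 0 \<or> k \<ge> 1" by linarith
    then have "a \<le> 0 \<or> a \<ge> 1" unfolding k by linarith
    then show "min x (1 - x) \<le> dist x a"
      using assms by (auto simp: dist_real_def)
  qed (auto intro: Ints_0)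
qed

text \<open>Splits the indices by their last binary digit, which is how level \<open>Suc n\<close>
  arises from level \<open>n\<close>.\<close>

lemma sum_lessThan_double:
  "sum F {..<2 * N} = (\<Sum>k<N. F (2 * k) + F (Suc (2 * k)))" for F :: "nat \<Rightarrow> 'a :: comm_monoid_add"
  by (induction N) (auto simp: add.assoc)

text \<open>The parameter of the rescaled copy over the \<open>k\<close>-th dyadic interval of level
  \<open>n\<close>. The parent interval is \<open>k div 2\<close>. The lowest bit of
  \<open>k\<close> is the newest digit and gets weight \<gamma>; the signs are the slopes of the
  distance to the integers on the two halves of the unit interval.\<close>

primrec slope :: "real \<Rightarrow> nat \<Rightarrow> nat \<Rightarrow> real" where
  "slope \<gamma> 0 k = 0"
| "slope \<gamma> (Suc n) k = \<gamma> * (slope \<gamma> n (k div 2) + (if even k then 1 else -1))"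

locale takagi =
  fixes lam \<gamma> :: real
  assumes lam: "0 < lam" "lam < 1" "1 < 2 * lam" and \<gamma>_eq: "\<gamma> = 1 / (2 * lam)"
begin

lemma \<gamma>: "0 < \<gamma>" "\<gamma> < 1" "lam * \<gamma> = 1 / 2"
  using lam by (auto simp: \<gamma>_eq field_simps)

lemma lam_power: "lam ^ n * \<gamma> ^ n = (1 / 2) ^ n"
  by (metis \<gamma>(3) power_mult_distrib)

abbreviation w :: "real \<Rightarrow> real" where "w \<equiv> W lam 2"

text \<open>The sum of \<gamma>^n over n >= 1: it bounds all slopes and the support of the Bernoulli
  convolution.\<close>

definition K :: real where "K = \<gamma> / (1 - \<gamma>)"

lemma K: "0 < K" "\<gamma> * (K + 1) = K"
  using \<gamma> by (auto simp: K_def field_simps)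

definition h :: "real \<Rightarrow> real \<Rightarrow> real" where "h \<theta> x = w x + \<theta> * x"

lemma summable_w: "summable (\<lambda>n. lam ^ n * infdist (2 ^ n * (x :: real)) \<int>)"
proof (rule summable_comparison_test')
  show "summable (\<lambda>n. lam ^ n)" using lam by (simp add: summable_geometric)
  show "norm (lam ^ n * infdist (2 ^ n * x) \<int>) \<le> lam ^ n" for n
    using lam infdist_Ints_le[of "2 ^ n * x"] infdist_nonneg[of "2 ^ n * x" \<int>]
    by (auto simp: abs_mult intro!: mult_left_le)
qed

lemma w_bounds: "0 \<le> w x" "w x \<le> 1 / (1 - lam)"
proof -
  show "0 \<le> w x"
    unfolding W_def using lam summable_w by (auto intro!: suminf_nonneg simp: infdist_nonneg)
  have "w x \<le> (\<Sum>n. lam ^ n)"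
    unfolding W_def using lam summable_w
    by (auto intro!: suminf_le mult_left_le infdist_Ints_le)
  then show "w x \<le> 1 / (1 - lam)"
    using lam by (simp add: suminf_geometric)
qed

lemma w_rec: "w x = infdist x \<int> + lam * w (2 * x)"
proof -
  have "w x = infdist x \<int> + (\<Sum>n. lam ^ Suc n * infdist (2 ^ Suc n * x) \<int>)"
    unfolding W_def using suminf_split_head[OF summable_w[of x]] by simp
  also have "(\<Sum>n. lam ^ Suc n * infdist (2 ^ Suc n * x) \<int>) = lam * w (2 * x)"
    unfolding W_def using suminf_mult[OF summable_w[of "2 * x"], of lam] by (simp add: mult_ac)
  finally show ?thesis .
qed

lemma w_add_of_nat: "w (x + of_nat m) = w x"
proof -
  have "infdist (2 ^ n * (x + of_nat m)) \<int> = infdist (2 ^ n * x) \<int>" for n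
    using infdist_Ints_add_of_nat[of "2 ^ n * x" "2 ^ n * m"] by (simp add: algebra_simps)
  then show ?thesis by (simp add: W_def)
qed

lemma borel_measurable_w [measurable]: "w \<in> borel_measurable borel"
proof -
  have [measurable]: "(\<lambda>x::real. infdist x \<int>) \<in> borel_measurable borel"
    by (intro borel_measurable_continuous_onI continuous_intros)
  show ?thesis
    unfolding W_def[abs_def] by measurable
qed

lemma borel_measurable_h [measurable (raw)]:
  assumes [measurable]: "f \<in> borel_measurable M" "g \<in> borel_measurable M"
  shows "(\<lambda>x. h (f x) (g x)) \<in> borel_measurable M"
  unfolding h_def by measurable

text \<open>On either half of the unit interval the first summand of \<open>w\<close> is affine with
  slope 1 or -1. By \<open>w_rec\<close> and \<open>lam * \<gamma> = 1 / 2\<close> this slope is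
  absorbed into the parameter of a copy scaled by \<open>lam\<close>; the constant left over cancels
  in the difference.\<close>

lemma h_diff_half:
  assumes "0 \<le> x" "x < 1" "0 \<le> y" "y < 1" "i < 2"
  shows "h \<theta> ((of_nat i + x) / 2) - h \<theta> ((of_nat i + y) / 2) =
    lam * (h (\<gamma> * (\<theta> + (if even i then 1 else -1))) x - h (\<gamma> * (\<theta> + (if even i then 1 else -1))) y)"
proof -
  have *: "h \<theta> ((of_nat i + x) / 2) =
    lam * h (\<gamma> * (\<theta> + (if even i then 1 else -1))) x + of_nat i * (\<theta> + 1) / 2"
    if x: "0 \<le> x" "x < 1" for x
  proof -
    have "w ((of_nat i + x) / 2) = infdist ((of_nat i + x) / 2) \<int> + lam * w x"
      using w_rec[of "(of_nat i + x) / 2"] w_add_of_nat[of x i] by (simp add: add.commute add_divide_distrib)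
    moreover have "infdist ((of_nat i + x) / 2) \<int> = (if even i then 1 else -1) * x / 2 + of_nat i / 2"
      using x \<open>i < 2\<close> by (subst infdist_Ints_unit_interval) (auto simp: less_2_cases_iff min_def field_simps)
    moreover have "lam * h (\<gamma> * (\<theta> + (if even i then 1 else -1))) x
        = lam * w x + (\<theta> + (if even i then 1 else -1)) * x / 2"
      using \<gamma>(3) by (simp only: h_def distrib_left mult.assoc[symmetric]) simp
    moreover have "h \<theta> ((of_nat i + x) / 2) = w ((of_nat i + x) / 2) + \<theta> * of_nat i / 2 + \<theta> * x / 2"
      by (simp add: h_def field_simps)
    ultimately show ?thesis
      by (simp only: distrib_left distrib_right add_divide_distrib mult.commute)
  qed
  show ?thesis
    using assms by (simp add: * right_diff_distrib)
qed

text \<open>Induction peels off the last digit of \<open>k\<close>: both points lie in one half of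
  the parent interval \<open>k div 2\<close>, so the hypothesis applies there and
  \<open>h_diff_half\<close> passes to the half.\<close>

lemma w_diff_dyadic:
  assumes "0 \<le> x" "x < 1" "0 \<le> y" "y < 1"
  shows "w ((of_nat k + x) / 2 ^ n) - w ((of_nat k + y) / 2 ^ n)
    = lam ^ n * (h (slope \<gamma> n k) x - h (slope \<gamma> n k) y)"
  using assms
proof (induction n arbitrary: k x y)
  case 0
  then show ?case
    using w_add_of_nat[of x k] w_add_of_nat[of y k] by (simp add: h_def add.commute)
next
  case (Suc n)
  define i where "i = k mod 2"
  have k: "real k = 2 * real (k div 2) + real i"
    unfolding i_def by (metis div_mult_mod_eq mult.commute of_nat_add of_nat_mult of_nat_numeral)
  have i: "i < 2" "even i \<longleftrightarrow> even k" by (auto simp: i_def)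
  have split: "(real k + z) / 2 ^ Suc n = (real (k div 2) + (real i + z) / 2) / 2 ^ n" for z
    by (simp add: k field_simps)
  have "real i \<le> 1" using i by simp
  then have "w ((real k + x) / 2 ^ Suc n) - w ((real k + y) / 2 ^ Suc n)
    = lam ^ n * (h (slope \<gamma> n (k div 2)) ((real i + x) / 2) - h (slope \<gamma> n (k div 2)) ((real i + y) / 2))"
    unfolding split using Suc.prems by (intro Suc.IH) auto
  also have "\<dots> = lam ^ Suc n * (h (slope \<gamma> (Suc n) k) x - h (slope \<gamma> (Suc n) k) y)"
    using Suc.prems i by (subst h_diff_half) auto
  finally show ?case .
qed

text \<open>\<open>K\<close> is the fixed point of t -> \<gamma> (t + 1).\<close>

lemma abs_slope_le: "\<bar>slope \<gamma> n k\<bar> \<le> K"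
proof (induction n arbitrary: k)
  case (Suc n)
  have "\<bar>slope \<gamma> n (k div 2) + (if even k then 1 else -1)\<bar> \<le> K + 1"
    using Suc[of "k div 2"] by auto
  then have "\<gamma> * \<bar>slope \<gamma> n (k div 2) + (if even k then 1 else -1)\<bar> \<le> \<gamma> * (K + 1)"
    using \<gamma> by (intro mult_left_mono) auto
  then show ?case using K \<gamma> by (simp add: abs_mult)
qed (use K in auto)

end

subsection \<open>Self-similarity of the Bernoulli convolution\<close>

lemma prob_space_fair_sign: "prob_space fair_sign"
  unfolding fair_sign_def by (intro prob_space.prob_space_distr measure_pmf.prob_space_axioms) simp

lemma AE_fair_sign: "AE z in fair_sign. z = -1 \<or> z = 1"
  unfolding fair_sign_def by (subst AE_distr_iff) (auto simp: AE_measure_pmf_iff)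

lemma nn_integral_fair_sign:
  assumes [measurable]: "F \<in> borel_measurable borel"
  shows "(\<integral>\<^sup>+z. F z \<partial>fair_sign) = (F 1 + F (-1)) / 2"
proof -
  have "(\<integral>\<^sup>+z. F z \<partial>fair_sign) = (\<Sum>z\<in>{-1, 1}. F z * ennreal (1 / 2))"
    unfolding fair_sign_def by (simp add: nn_integral_distr nn_integral_measure_pmf_finite)
  also have "\<dots> = (F 1 + F (-1)) * ennreal (1 / 2)"
    by (simp add: distrib_right add.commute)
  also have "\<dots> = (F 1 + F (-1)) / 2"
    using divide_ennreal[of 1 2] by (simp add: divide_ennreal_def)
  finally show ?thesis .
qed

interpretation fair_sign: prob_space fair_sign
  by (rule prob_space_fair_sign)

text \<open>Gives \<open>PiM_iter\<close>: prepending an independent sign to a random sequence of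
  signs preserves its law.\<close>

interpretation signs: sequence_space fair_sign
  ..

text \<open>Points of the product space are arbitrary real sequences; this almost sure bound makes
  the series converge, so that \<open>suminf\<close> is a genuine sum.\<close>

lemma AE_signs: "AE \<omega> in Pi\<^sub>M UNIV (\<lambda>_::nat. fair_sign). \<forall>n. \<bar>\<omega> n\<bar> \<le> 1"
proof -
  have "AE \<omega> in Pi\<^sub>M UNIV (\<lambda>_::nat. fair_sign). \<bar>\<omega> n\<bar> \<le> 1" for n
    by (rule AE_PiM_component[where P = "\<lambda>x. \<bar>x\<bar> \<le> 1"])
       (use AE_fair_sign in \<open>auto simp: prob_space_fair_sign elim!: eventually_mono\<close>)
  then show ?thesis by (simp add: AE_all_countable)
qed

lemma sets_bernoulli_convolution [simp, measurable_cong]: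
  "sets (bernoulli_convolution \<gamma>) = sets borel"
  by (simp add: bernoulli_convolution_def)

lemma space_bernoulli_convolution [simp]: "space (bernoulli_convolution \<gamma>) = UNIV"
  by (simp add: bernoulli_convolution_def)

lemma measurable_signed_series [measurable]:
  "(\<lambda>\<omega>. \<Sum>n. \<gamma> ^ Suc n * \<omega> n :: real) \<in> borel_measurable (Pi\<^sub>M UNIV (\<lambda>_::nat. fair_sign))"
proof -
  have [measurable]: "(\<lambda>\<omega>. \<omega> n) \<in> borel_measurable (Pi\<^sub>M UNIV (\<lambda>_::nat. fair_sign))" for n
    using measurable_component_singleton[of n UNIV "\<lambda>_. fair_sign"] by (simp cong: measurable_cong_sets)
  show ?thesis by measurable
qed

lemma emeasure_bernoulli_convolution_UNIV: "emeasure (bernoulli_convolution \<gamma>) UNIV = 1"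
proof -
  have "prob_space (bernoulli_convolution \<gamma>)"
    unfolding bernoulli_convolution_def
    by (rule signs.prob_space_distr) (rule measurable_signed_series)
  then show ?thesis
    using prob_space.emeasure_space_1 by fastforce
qed

context takagi
begin

lemma summable_signed:
  assumes "\<And>n. \<bar>\<omega> n\<bar> \<le> (1 :: real)"
  shows "summable (\<lambda>n. \<gamma> ^ Suc n * \<omega> n)" "\<bar>\<Sum>n. \<gamma> ^ Suc n * \<omega> n\<bar> \<le> K"
proof -
  have s: "(\<lambda>n. \<gamma> ^ Suc n) sums K"
    using sums_mult[OF geometric_sums[of \<gamma>], of \<gamma>] \<gamma> by (simp add: K_def)
  have b: "norm (\<gamma> ^ Suc n * \<omega> n) \<le> \<gamma> ^ Suc n" for n
    using \<gamma> assms[of n] by (simp add: abs_mult power_abs mult_left_le)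
  show "summable (\<lambda>n. \<gamma> ^ Suc n * \<omega> n)"
    by (rule summable_comparison_test'[OF sums_summable[OF s] b])
  show "\<bar>\<Sum>n. \<gamma> ^ Suc n * \<omega> n\<bar> \<le> K"
    using norm_suminf_le[OF b sums_summable[OF s]] sums_unique[OF s] by simp
qed

lemma AE_bernoulli_convolution: "AE \<theta> in bernoulli_convolution \<gamma>. \<bar>\<theta>\<bar> \<le> K"
  unfolding bernoulli_convolution_def
  using AE_signs summable_signed(2)
  by (subst AE_distr_iff) (auto elim!: eventually_mono)

text \<open>Splitting off the first sign: the random sum has the law of \<gamma> (Z + \<Theta>),
  with Z a fair sign independent of a copy \<Theta> of the sum.\<close>

lemma emeasure_bernoulli_convolution_step:
  assumes [measurable]: "A \<in> sets borel"
  shows "emeasure (bernoulli_convolution \<gamma>) A =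
    (emeasure (bernoulli_convolution \<gamma>) {\<theta>. \<gamma> * (1 + \<theta>) \<in> A} +
     emeasure (bernoulli_convolution \<gamma>) {\<theta>. \<gamma> * (-1 + \<theta>) \<in> A}) / 2"
proof -
  let ?S = "Pi\<^sub>M UNIV (\<lambda>_::nat. fair_sign)"
  let ?\<nu> = "bernoulli_convolution \<gamma>"
  define X where "X = (\<lambda>\<omega>::nat \<Rightarrow> real. \<Sum>n. \<gamma> ^ Suc n * \<omega> n)"
  have [measurable]: "X \<in> borel_measurable ?S"
    unfolding X_def by (rule measurable_signed_series)
  have cons [measurable]: "(\<lambda>(z, \<omega>). case_nat z \<omega>) \<in> measurable (fair_sign \<Otimes>\<^sub>M ?S) ?S"
    by measurable
  \<comment> \<open>The identity is claimed for bounded sequences, where both series converge;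
    \<open>inner\<close> then uses it almost everywhere.\<close>
  have X_cons: "X (case_nat z \<omega>) = \<gamma> * (z + X \<omega>)" if "\<forall>n. \<bar>\<omega> n\<bar> \<le> 1" for z \<omega>
  proof -
    have "summable (\<lambda>n. \<gamma> ^ Suc (Suc n) * \<omega> n)"
      using summable_mult[OF summable_signed(1)[of \<omega>], of \<gamma>] that by (simp add: mult.assoc)
    then have "summable (\<lambda>n. \<gamma> ^ Suc n * case_nat z \<omega> n)"
      by (subst summable_Suc_iff[symmetric]) simp
    from suminf_split_head[OF this]
    have "X (case_nat z \<omega>) = \<gamma> * z + (\<Sum>n. \<gamma> * (\<gamma> ^ Suc n * \<omega> n))"
      by (simp add: X_def mult.assoc)
    also have "(\<Sum>n. \<gamma> * (\<gamma> ^ Suc n * \<omega> n)) = \<gamma> * X \<omega>"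
      unfolding X_def using summable_signed(1)[of \<omega>] that by (subst suminf_mult) auto
    finally show ?thesis by (simp add: distrib_left)
  qed
  have \<nu>: "?\<nu> = distr ?S borel X"
    by (simp add: bernoulli_convolution_def X_def)
  have inner: "(\<integral>\<^sup>+\<omega>. indicator A (X (case_nat z \<omega>)) \<partial>?S) = emeasure ?\<nu> {\<theta>. \<gamma> * (z + \<theta>) \<in> A}" for z
  proof -
    have "(\<integral>\<^sup>+\<omega>. indicator A (X (case_nat z \<omega>)) \<partial>?S) =
        (\<integral>\<^sup>+\<omega>. indicator {\<theta>. \<gamma> * (z + \<theta>) \<in> A} (X \<omega>) \<partial>?S)"
      by (rule nn_integral_cong_AE) (use AE_signs X_cons in \<open>auto elim!: eventually_mono simp: indicator_def\<close>)
    also have "\<dots> = (\<integral>\<^sup>+\<theta>. indicator {\<theta>. \<gamma> * (z + \<theta>) \<in> A} \<theta> \<partial>?\<nu>)"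
      unfolding \<nu> by (subst nn_integral_distr) auto
    also have "\<dots> = emeasure ?\<nu> {\<theta>. \<gamma> * (z + \<theta>) \<in> A}"
      by (rule nn_integral_indicator) simp
    finally show ?thesis .
  qed
  have "emeasure ?\<nu> A = (\<integral>\<^sup>+\<omega>. indicator A (X \<omega>) \<partial>?S)"
    unfolding \<nu> by (subst nn_integral_indicator[symmetric], simp, subst nn_integral_distr) auto
  also have "\<dots> = (\<integral>\<^sup>+\<omega>. indicator A (X \<omega>) \<partial>distr (fair_sign \<Otimes>\<^sub>M ?S) ?S (\<lambda>(z, \<omega>). case_nat z \<omega>))"
    by (simp only: signs.PiM_iter)
  also have "\<dots> = (\<integral>\<^sup>+p. indicator A (X (case_nat (fst p) (snd p))) \<partial>(fair_sign \<Otimes>\<^sub>M ?S))"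
    by (subst nn_integral_distr) (auto simp: case_prod_beta intro!: nn_integral_cong)
  also have "\<dots> = (\<integral>\<^sup>+z. \<integral>\<^sup>+\<omega>. indicator A (X (case_nat z \<omega>)) \<partial>?S \<partial>fair_sign)"
    by (subst signs.nn_integral_fst[symmetric]) auto
  also have "\<dots> = (emeasure ?\<nu> {\<theta>. \<gamma> * (1 + \<theta>) \<in> A} + emeasure ?\<nu> {\<theta>. \<gamma> * (-1 + \<theta>) \<in> A}) / 2"
    unfolding inner[symmetric]
    by (rule nn_integral_fair_sign) measurable
  finally show ?thesis .
qed

text \<open>Iterating the splitting \<open>n\<close> times: the random sum has the law of
  \<open>slope \<gamma> n k\<close> plus \<gamma>^n times an independent copy of itself, with
  \<open>k\<close> uniform below 2^n. In the induction the two signs lead to the children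
  \<open>2 * k\<close> and \<open>Suc (2 * k)\<close>.\<close>

lemma emeasure_bernoulli_convolution_slope:
  assumes "A \<in> sets borel"
  shows "2 ^ n * emeasure (bernoulli_convolution \<gamma>) A =
    (\<Sum>k<2 ^ n. emeasure (bernoulli_convolution \<gamma>) {\<theta>. slope \<gamma> n k + \<gamma> ^ n * \<theta> \<in> A})"
  using assms
proof (induction n arbitrary: A)
  case (Suc n)
  let ?\<nu> = "bernoulli_convolution \<gamma>"
  note [measurable] = \<open>A \<in> sets borel\<close>
  have eq: "{\<theta>. slope \<gamma> n k + \<gamma> ^ n * \<theta> \<in> {\<theta>. \<gamma> * (e + \<theta>) \<in> A}} =
    {\<theta>. \<gamma> * (slope \<gamma> n k + e) + \<gamma> ^ Suc n * \<theta> \<in> A}" for k e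
    by (simp add: algebra_simps)
  have double: "2 * emeasure ?\<nu> A = emeasure ?\<nu> {\<theta>. \<gamma> * (1 + \<theta>) \<in> A} + emeasure ?\<nu> {\<theta>. \<gamma> * (-1 + \<theta>) \<in> A}"
    using emeasure_bernoulli_convolution_step[OF \<open>A \<in> sets borel\<close>]
    by (simp add: ennreal_times_divide mult_divide_eq_ennreal mult.commute[of 2]
        del: distrib_right_numeral distrib_left_numeral)
  have "2 ^ Suc n * emeasure ?\<nu> A = 2 ^ n * (2 * emeasure ?\<nu> A)"
    by (simp add: mult_ac)
  also have "\<dots> = 2 ^ n * emeasure ?\<nu> {\<theta>. \<gamma> * (1 + \<theta>) \<in> A} + 2 ^ n * emeasure ?\<nu> {\<theta>. \<gamma> * (-1 + \<theta>) \<in> A}"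
    unfolding double by (simp add: distrib_left)
  also have "\<dots> = (\<Sum>k<2 ^ n. emeasure ?\<nu> {\<theta>. slope \<gamma> n k + \<gamma> ^ n * \<theta> \<in> {\<theta>. \<gamma> * (1 + \<theta>) \<in> A}} +
      emeasure ?\<nu> {\<theta>. slope \<gamma> n k + \<gamma> ^ n * \<theta> \<in> {\<theta>. \<gamma> * (-1 + \<theta>) \<in> A}})"
    by (simp only: sum.distrib) (intro arg_cong2[where f = "(+)"] Suc.IH; measurable)
  also have "\<dots> = (\<Sum>k<2 ^ Suc n. emeasure ?\<nu> {\<theta>. slope \<gamma> (Suc n) k + \<gamma> ^ Suc n * \<theta> \<in> A})"
    unfolding eq power_Suc[of 2] sum_lessThan_double by simp
  finally show ?case .
qed simp

end

subsection \<open>Transversality\<close>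

text \<open>On each side of \<open>x\<close> the kernel has a logarithmic antiderivative. With
  \<open>r\<close> of order \<gamma>^n the logarithm produces the factor n in the bound O(n
  \<gamma>^n).\<close>

lemma nn_integral_min_kernel:
  fixes a r :: real
  assumes "0 < a" "0 < r" "0 \<le> x" "x \<le> 1"
  shows "(\<integral>\<^sup>+y. ennreal (4 * a * r / (r + a * \<bar>x - y\<bar>)) * indicator {0..<1} y \<partial>lborel)
    \<le> ennreal (8 * r * ln ((r + a) / r))"
proof -
  have le: "ln (r + a * z) - ln r \<le> ln ((r + a) / r)" if "0 \<le> z" "z \<le> 1" for z
  proof -
    have "ln (r + a * z) \<le> ln (r + a)"
      using assms that by (intro ln_mono add_mono mult_left_le add_pos_nonneg) auto
    then show ?thesis using assms by (simp add: ln_div)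
  qed
  have pos: "0 < r + a * z" if "0 \<le> z" for z
    using assms that by (intro add_pos_nonneg) auto
  have left: "(\<integral>\<^sup>+y. ennreal (4 * a * r / (r + a * (x - y))) * indicator {0..x} y \<partial>lborel)
      = ennreal (- 4 * r * ln (r + a * (x - x)) - - 4 * r * ln (r + a * (x - 0)))"
  proof (intro nn_integral_FTC_Icc)
    fix y assume "y \<in> {0..x}"
    then have y: "0 < r + a * (x - y)" using pos[of "x - y"] by simp
    show "((\<lambda>y. - 4 * r * ln (r + a * (x - y))) has_real_derivative 4 * a * r / (r + a * (x - y)))
        (at y)"
      by (rule derivative_eq_intros refl y | simp)+
    show "0 \<le> 4 * a * r / (r + a * (x - y))"
      using assms y by simp
  qed (use assms in auto)
  have right: "(\<integral>\<^sup>+y. ennreal (4 * a * r / (r + a * (y - x))) * indicator {x..1} y \<partial>lborel)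
      = ennreal (4 * r * ln (r + a * (1 - x)) - 4 * r * ln (r + a * (x - x)))"
  proof (intro nn_integral_FTC_Icc)
    fix y assume "y \<in> {x..1}"
    then have y: "0 < r + a * (y - x)" using pos[of "y - x"] by simp
    show "((\<lambda>y. 4 * r * ln (r + a * (y - x))) has_real_derivative 4 * a * r / (r + a * (y - x)))
        (at y)"
      by (rule derivative_eq_intros refl y | simp)+
    show "0 \<le> 4 * a * r / (r + a * (y - x))"
      using assms y by simp
  qed (use assms in auto)
  have "(\<integral>\<^sup>+y. ennreal (4 * a * r / (r + a * \<bar>x - y\<bar>)) * indicator {0..<1} y \<partial>lborel)
      \<le> (\<integral>\<^sup>+y. ennreal (4 * a * r / (r + a * (x - y))) * indicator {0..x} y
          + ennreal (4 * a * r / (r + a * (y - x))) * indicator {x..1} y \<partial>lborel)"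
    by (intro nn_integral_mono) (auto simp: indicator_def abs_if)
  also have "\<dots> = ennreal (- 4 * r * ln (r + a * (x - x)) - - 4 * r * ln (r + a * (x - 0)))
      + ennreal (4 * r * ln (r + a * (1 - x)) - 4 * r * ln (r + a * (x - x)))"
    unfolding left[symmetric] right[symmetric] by (intro nn_integral_add) auto
  also have "\<dots> = ennreal (4 * r * (ln (r + a * x) - ln r)) + ennreal (4 * r * (ln (r + a * (1 - x)) - ln r))"
    by (simp add: algebra_simps)
  also have "\<dots> \<le> ennreal (4 * r * ln ((r + a) / r)) + ennreal (4 * r * ln ((r + a) / r))"
    using assms le[of x] le[of "1 - x"] by (intro add_mono ennreal_leI mult_left_mono) auto
  also have "\<dots> = ennreal (8 * r * ln ((r + a) / r))"
    using assms by (subst ennreal_plus[symmetric]) (auto intro!: mult_nonneg_nonneg ln_ge_zero simp: field_simps)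
  finally show ?thesis .
qed

text \<open>The strip lies in an interval of length \<open>2 * a\<close> and, for nonzero
  \<open>d\<close>, in one of length \<open>2 * r / \<bar>d\<bar>\<close>. The right-hand side is
  the harmonic mean of the two lengths: it dominates their minimum and still makes sense at
  \<open>d = 0\<close>.\<close>

lemma emeasure_affine_strip:
  fixes a c d r :: real
  assumes "0 < a" "0 < r"
  shows "emeasure lborel {\<theta>. \<bar>\<theta>\<bar> \<le> a \<and> \<bar>c + \<theta> * d\<bar> \<le> r} \<le> ennreal (4 * a * r / (r + a * \<bar>d\<bar>))"
proof -
  have 1: "emeasure lborel {\<theta>. \<bar>\<theta>\<bar> \<le> a \<and> \<bar>c + \<theta> * d\<bar> \<le> r} \<le> ennreal (2 * a)"
  proof -
    have "emeasure lborel {\<theta>. \<bar>\<theta>\<bar> \<le> a \<and> \<bar>c + \<theta> * d\<bar> \<le> r} \<le> emeasure lborel {- a..a}"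
      by (intro emeasure_mono) auto
    then show ?thesis using assms by simp
  qed
  have 2: "emeasure lborel {\<theta>. \<bar>\<theta>\<bar> \<le> a \<and> \<bar>c + \<theta> * d\<bar> \<le> r} \<le> ennreal (2 * r / \<bar>d\<bar>)" if "d \<noteq> 0"
  proof -
    have "\<bar>\<theta> + c / d\<bar> \<le> r / \<bar>d\<bar>" if "\<bar>c + \<theta> * d\<bar> \<le> r" for \<theta>
    proof -
      have "\<bar>c + \<theta> * d\<bar> = \<bar>d\<bar> * \<bar>\<theta> + c / d\<bar>"
        using \<open>d \<noteq> 0\<close> by (simp add: abs_mult[symmetric] distrib_left mult.commute add.commute)
      then show ?thesis using that \<open>d \<noteq> 0\<close> by (simp add: field_simps)
    qed
    then have "{\<theta>. \<bar>\<theta>\<bar> \<le> a \<and> \<bar>c + \<theta> * d\<bar> \<le> r} \<subseteq> {- (c / d) - r / \<bar>d\<bar> .. - (c / d) + r / \<bar>d\<bar>}"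
      by (fastforce simp: abs_le_iff)
    then have "emeasure lborel {\<theta>. \<bar>\<theta>\<bar> \<le> a \<and> \<bar>c + \<theta> * d\<bar> \<le> r}
        \<le> emeasure lborel {- (c / d) - r / \<bar>d\<bar> .. - (c / d) + r / \<bar>d\<bar>}"
      by (intro emeasure_mono) auto
    then show ?thesis using assms by (simp add: mult.commute)
  qed
  \<comment> \<open>The case distinction decides which of the two lengths is the smaller
    one.\<close>
  show ?thesis
  proof (cases "a * \<bar>d\<bar> \<le> r")
    case True
    then have "2 * a \<le> 4 * a * r / (r + a * \<bar>d\<bar>)"
      using assms by (simp add: field_simps add_pos_nonneg)
    then show ?thesis using 1 by (meson ennreal_leI order_trans)
  next
    case False
    then have d: "d \<noteq> 0" using assms by auto
    then have "2 * r / \<bar>d\<bar> \<le> 4 * a * r / (r + a * \<bar>d\<bar>)"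
      using assms False by (simp add: field_simps add_pos_nonneg)
    then show ?thesis using 2[OF d] by (meson ennreal_leI order_trans)
  qed
qed

context takagi
begin

text \<open>The image of Lebesgue measure on the unit interval under \<open>h \<theta>\<close>,
  evaluated on the closed interval of radius \<open>r\<close> about \<open>h \<theta> x\<close>. The
  integral form suits Fubini and joint measurability.\<close>

definition proj_mass :: "real \<Rightarrow> real \<Rightarrow> real \<Rightarrow> ennreal" where
  "proj_mass \<theta> x r = (\<integral>\<^sup>+y. indicator {0..<1} y * indicator {z. \<bar>z\<bar> \<le> r} (h \<theta> x - h \<theta> y) \<partial>lborel)"

lemma borel_measurable_proj_mass [measurable (raw)]:
  assumes [measurable]: "f \<in> borel_measurable M" "g \<in> borel_measurable M"
  shows "(\<lambda>z. proj_mass (f z) (g z) r) \<in> borel_measurable M"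
proof -
  have "(\<lambda>p. proj_mass (fst p) (snd p) r) \<in> borel_measurable borel"
    unfolding proj_mass_def by (subst borel_prod[symmetric]) measurable
  from measurable_compose[OF measurable_Pair[OF assms, unfolded borel_prod] this]
  show ?thesis by simp
qed

lemma nn_integral_proj_mass_le:
  assumes "0 < r" "0 \<le> x" "x < 1"
  shows "(\<integral>\<^sup>+\<theta>. indicator {-K..K} \<theta> * proj_mass \<theta> x r \<partial>lborel) \<le> ennreal (8 * r * ln ((r + K) / r))"
proof -
  let ?H = "\<lambda>\<theta> y. indicator {z. \<bar>z\<bar> \<le> r} (h \<theta> x - h \<theta> y) :: ennreal"
  have "(\<integral>\<^sup>+\<theta>. indicator {-K..K} \<theta> * proj_mass \<theta> x r \<partial>lborel)
      = (\<integral>\<^sup>+\<theta>. \<integral>\<^sup>+y. indicator {-K..K} \<theta> * (indicator {0..<1} y * ?H \<theta> y) \<partial>lborel \<partial>lborel)"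
    unfolding proj_mass_def by (intro nn_integral_cong nn_integral_cmult[symmetric]) measurable
  also have "\<dots> = (\<integral>\<^sup>+y. \<integral>\<^sup>+\<theta>. indicator {-K..K} \<theta> * (indicator {0..<1} y * ?H \<theta> y) \<partial>lborel \<partial>lborel)"
    by (rule lborel_pair.Fubini') measurable
  also have "\<dots> \<le> (\<integral>\<^sup>+y. ennreal (4 * K * r / (r + K * \<bar>x - y\<bar>)) * indicator {0..<1} y \<partial>lborel)"
  proof (rule nn_integral_mono)
    fix y
    have "(\<integral>\<^sup>+\<theta>. indicator {-K..K} \<theta> * (indicator {0..<1} y * ?H \<theta> y) \<partial>lborel)
        = (\<integral>\<^sup>+\<theta>. indicator {0..<1} y * indicator {\<theta>. \<bar>\<theta>\<bar> \<le> K \<and> \<bar>(w x - w y) + \<theta> * (x - y)\<bar> \<le> r} \<theta> \<partial>lborel)"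
      by (intro nn_integral_cong) (auto simp: indicator_def h_def algebra_simps)
    also have "\<dots> = indicator {0..<1} y * emeasure lborel {\<theta>. \<bar>\<theta>\<bar> \<le> K \<and> \<bar>(w x - w y) + \<theta> * (x - y)\<bar> \<le> r}"
      by (subst nn_integral_cmult) auto
    also have "\<dots> \<le> indicator {0..<1} y * ennreal (4 * K * r / (r + K * \<bar>x - y\<bar>))"
      by (intro mult_left_mono emeasure_affine_strip K assms) auto
    finally show "(\<integral>\<^sup>+\<theta>. indicator {-K..K} \<theta> * (indicator {0..<1} y * ?H \<theta> y) \<partial>lborel)
        \<le> ennreal (4 * K * r / (r + K * \<bar>x - y\<bar>)) * indicator {0..<1} y"
      by (simp add: mult.commute)
  qed
  also have "\<dots> \<le> ennreal (8 * r * ln ((r + K) / r))"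
    using assms K by (intro nn_integral_min_kernel) auto
  finally show ?thesis .
qed

text \<open>Points of the unit interval are less than 1 apart, so a change of the parameter by
  \<open>e\<close> moves \<open>h \<theta> x - h \<theta> y\<close> by at most
  \<open>e\<close>.\<close>

lemma proj_mass_perturb:
  assumes "0 \<le> x" "x < 1" "\<bar>\<theta> - \<theta>'\<bar> \<le> e"
  shows "proj_mass \<theta> x r \<le> proj_mass \<theta>' x (r + e)"
  unfolding proj_mass_def
proof (intro nn_integral_mono)
  fix y
  have "\<bar>h \<theta>' x - h \<theta>' y\<bar> \<le> r + e" if "0 \<le> y" "y < 1" "\<bar>h \<theta> x - h \<theta> y\<bar> \<le> r"
  proof -
    have "\<bar>\<theta> - \<theta>'\<bar> * \<bar>x - y\<bar> \<le> e * 1"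
      using assms that by (intro mult_mono) auto
    moreover have "h \<theta>' x - h \<theta>' y = (h \<theta> x - h \<theta> y) - (\<theta> - \<theta>') * (x - y)"
      by (simp add: h_def algebra_simps)
    ultimately show ?thesis using that by (simp add: abs_mult[symmetric])
  qed
  then show "indicator {0..<1} y * indicator {z. \<bar>z\<bar> \<le> r} (h \<theta> x - h \<theta> y)
      \<le> (indicator {0..<1} y * indicator {z. \<bar>z\<bar> \<le> r + e} (h \<theta>' x - h \<theta>' y) :: ennreal)"
    by (auto simp: indicator_def)
qed

end

subsection \<open>Lower bound\<close>

text \<open>The unit interval is cut into its dyadic intervals of level \<open>n\<close>, and each
  is rescaled to the unit interval.\<close>

lemma nn_integral_unit_dyadic:
  assumes [measurable]: "F \<in> borel_measurable borel"
  shows "(\<integral>\<^sup>+x. indicator {0..<1::real} x * F x \<partial>lborel) =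
    ennreal ((1 / 2) ^ n) * (\<Sum>k<2 ^ n. \<integral>\<^sup>+x. indicator {0..<1} x * F ((real k + x) / 2 ^ n) \<partial>lborel)"
proof -
  have split: "indicator {0..<1} x = (\<Sum>k<2 ^ n. indicator {0..<1} (2 ^ n * x - real k) :: ennreal)" for x :: real
  proof (cases "x \<in> {0..<1}")
    case True
    define j where "j = nat \<lfloor>2 ^ n * x\<rfloor>"
    have j: "real j = of_int \<lfloor>2 ^ n * x\<rfloor>"
      using True by (simp add: j_def)
    have "real j < 2 ^ n" using True j by (smt (verit) mult_less_cancel_left2 of_int_floor_le atLeastLessThan_iff zero_less_power)
    then have "j < 2 ^ n" by (metis of_nat_less_iff of_nat_numeral of_nat_power)
    have "2 ^ n * x - real k \<in> {0..<1} \<longleftrightarrow> k = j" for k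
      using j by (auto simp: algebra_simps) linarith+
    then have "(\<Sum>k<2 ^ n. indicator {0..<1} (2 ^ n * x - real k) :: ennreal) = (\<Sum>k<2 ^ n. if k = j then 1 else 0)"
      by (intro sum.cong) (simp_all add: indicator_def)
    then show ?thesis using True \<open>j < 2 ^ n\<close> by simp
  next
    case False
    have "2 ^ n * x - real k \<notin> {0..<1}" if "k < 2 ^ n" for k
    proof
      assume a: "2 ^ n * x - real k \<in> {0..<1}"
      have "real k + 1 \<le> 2 ^ n"
        using that by (metis Suc_leI of_nat_Suc of_nat_le_iff of_nat_numeral of_nat_power add.commute)
      with a have "0 \<le> 2 ^ n * x \<and> 2 ^ n * x < 2 ^ n * 1"
        unfolding atLeastLessThan_iff by linarith
      then have "0 \<le> x" "x < 1"
        using mult_less_cancel_left_pos[of "2 ^ n" x 1] mult_le_cancel_left_pos[of "2 ^ n" 0 x] by simp_all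
      then show False using False by auto
    qed
    then have "(\<Sum>k<2 ^ n. indicator {0..<1} (2 ^ n * x - real k) :: ennreal) = 0"
      by (intro sum.neutral) (simp del: atLeastLessThan_iff)
    then show ?thesis using False by simp
  qed
  have "(\<integral>\<^sup>+x. indicator {0..<1::real} x * F x \<partial>lborel) =
      (\<Sum>k<2 ^ n. \<integral>\<^sup>+x. indicator {0..<1} (2 ^ n * x - real k) * F x \<partial>lborel)"
  proof -
    have "(\<integral>\<^sup>+x. indicator {0..<1::real} x * F x \<partial>lborel) =
        (\<integral>\<^sup>+x. (\<Sum>k<2 ^ n. indicator {0..<1} (2 ^ n * x - real k) * F x) \<partial>lborel)"
      by (rule nn_integral_cong, subst split, rule sum_distrib_right)
    then show ?thesis
      by (subst (asm) nn_integral_sum) auto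
  qed
  also have "\<dots> = (\<Sum>k<2 ^ n. ennreal ((1 / 2) ^ n) *
      (\<integral>\<^sup>+x. indicator {0..<1} x * F ((real k + x) / 2 ^ n) \<partial>lborel))"
  proof (rule sum.cong[OF refl])
    fix k
    show "(\<integral>\<^sup>+x. indicator {0..<1} (2 ^ n * x - real k) * F x \<partial>lborel) =
      ennreal ((1 / 2) ^ n) * (\<integral>\<^sup>+x. indicator {0..<1} x * F ((real k + x) / 2 ^ n) \<partial>lborel)"
    proof -
      have "2 ^ n * (real k / 2 ^ n + (1 / 2) ^ n * x) - real k = x"
        "real k / 2 ^ n + (1 / 2) ^ n * x = (real k + x) / 2 ^ n" for x
        by (simp_all add: field_simps)
      then show ?thesis
        by (subst nn_integral_real_affine[where c = "(1 / 2) ^ n" and t = "real k / 2 ^ n"]) simp_all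
    qed
  qed
  finally show ?thesis by (simp add: sum_distrib_left)
qed

locale takagi_L2 = takagi +
  fixes f :: "real \<Rightarrow> real"
  assumes f_measurable [measurable]: "f \<in> borel_measurable borel"
    and f_nonneg: "0 \<le> f x"
    and density: "bernoulli_convolution \<gamma> = density lborel (\<lambda>x. ennreal (f x))"
    and square_integrable: "integrable lborel (\<lambda>x. (f x)\<^sup>2)"

section \<open>Windows on the graph and exceptional sets\<close>

context takagi
begin

text \<open>The set whose measure the overview calls \<open>m\<^sub>n (x)\<close>; equality of the
  floors says that both points lie in the same dyadic interval of level \<open>n\<close>.\<close>

definition window :: "nat \<Rightarrow> real \<Rightarrow> real set" where
  "window n x = {y \<in> {0..<1}. \<lfloor>2 ^ n * y\<rfloor> = \<lfloor>2 ^ n * x\<rfloor> \<and> \<bar>w x - w y\<bar> \<le> (1 / 2) ^ n}"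

lemma sets_window [measurable]: "window n x \<in> sets borel"
  unfolding window_def by measurable

text \<open>The affine substitution contributes the factor 2^-n; by \<open>w_diff_dyadic\<close> and
  \<open>lam_power\<close> the height 2^-n becomes \<gamma>^n.\<close>

lemma emeasure_window_dyadic:
  assumes "k < 2 ^ n" "0 \<le> x" "x < 1"
  shows "emeasure lborel (window n ((real k + x) / 2 ^ n)) = ennreal ((1 / 2) ^ n) * proj_mass (slope \<gamma> n k) x (\<gamma> ^ n)"
proof -
  have k: "real k + 1 \<le> 2 ^ n"
    using assms by (metis Suc_leI of_nat_Suc of_nat_le_iff of_nat_numeral of_nat_power add.commute)
  have iff: "real k / 2 ^ n + (1 / 2) ^ n * y \<in> window n ((real k + x) / 2 ^ n) \<longleftrightarrow>
    y \<in> {0..<1} \<and> \<bar>h (slope \<gamma> n k) x - h (slope \<gamma> n k) y\<bar> \<le> \<gamma> ^ n" for y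
  proof -
    have e: "real k / 2 ^ n + (1 / 2) ^ n * y = (real k + y) / 2 ^ n"
      by (simp add: field_simps)
    have fl: "\<lfloor>2 ^ n * ((real k + y) / 2 ^ n)\<rfloor> = \<lfloor>2 ^ n * ((real k + x) / 2 ^ n)\<rfloor> \<longleftrightarrow> y \<in> {0..<1}"
    proof -
      have "\<lfloor>x\<rfloor> = 0" using assms by (simp add: floor_eq_iff)
      then show ?thesis by (simp add: floor_eq_iff[of y 0])
    qed
    show ?thesis
    proof (cases "y \<in> {0..<1}")
      case False
      then show ?thesis unfolding e window_def mem_Collect_eq fl by blast
    next
      case True
      have "(real k + y) / 2 ^ n \<in> {0..<1}"
        using True k by (simp add: divide_less_eq)
      moreover have "\<bar>w ((real k + x) / 2 ^ n) - w ((real k + y) / 2 ^ n)\<bar> =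
          lam ^ n * \<bar>h (slope \<gamma> n k) x - h (slope \<gamma> n k) y\<bar>"
        using True assms lam by (subst w_diff_dyadic) (auto simp: abs_mult)
      moreover have "lam ^ n * z \<le> (1 / 2) ^ n \<longleftrightarrow> z \<le> \<gamma> ^ n" for z
        using lam by (simp add: lam_power[symmetric])
      ultimately show ?thesis
        using True unfolding e window_def mem_Collect_eq fl by simp
    qed
  qed
  have "emeasure lborel (window n ((real k + x) / 2 ^ n)) = (\<integral>\<^sup>+y. indicator (window n ((real k + x) / 2 ^ n)) y \<partial>lborel)"
    by simp
  also have "\<dots> = ennreal ((1 / 2) ^ n) *
      (\<integral>\<^sup>+y. indicator (window n ((real k + x) / 2 ^ n)) (real k / 2 ^ n + (1 / 2) ^ n * y) \<partial>lborel)"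
    by (subst nn_integral_real_affine[where c = "(1 / 2) ^ n" and t = "real k / 2 ^ n"]) auto
  also have "\<dots> = ennreal ((1 / 2) ^ n) * proj_mass (slope \<gamma> n k) x (\<gamma> ^ n)"
    unfolding proj_mass_def
    by (intro arg_cong2[where f = "(*)"] nn_integral_cong) (use iff in \<open>auto simp: indicator_def\<close>)
  finally show ?thesis .
qed

text \<open>The factor 2^-n of \<open>emeasure_window_dyadic\<close> is built into the threshold, so
  that projected masses are compared with \<tau>^n. For \<open>\<tau> = 2 powr (1 - s)\<close> the
  threshold is 2^(-ns).\<close>

definition bad :: "real \<Rightarrow> nat \<Rightarrow> real set" where
  "bad \<tau> n = {x \<in> {0..<1}. ennreal ((\<tau> / 2) ^ n) < emeasure lborel (window n x)}"

lemma sets_bad [measurable]: "bad \<tau> n \<in> sets borel"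
proof -
  have "emeasure lborel (window n x) =
      (\<integral>\<^sup>+y. indicator {p. snd p \<in> {0..<1} \<and> \<lfloor>2 ^ n * snd p\<rfloor> = \<lfloor>2 ^ n * fst p\<rfloor> \<and>
        \<bar>w (fst p) - w (snd p)\<bar> \<le> (1 / 2) ^ n} (x, y) \<partial>lborel)" for x
  proof -
    have "emeasure lborel (window n x) = (\<integral>\<^sup>+y. indicator (window n x) y \<partial>lborel)"
      by simp
    then show ?thesis
      by (simp only: window_def indicator_def mem_Collect_eq fst_conv snd_conv)
  qed
  then have [measurable]: "(\<lambda>x. emeasure lborel (window n x)) \<in> borel_measurable borel"
    by simp
  show ?thesis unfolding bad_def by measurable
qed

text \<open>The left side counts the slopes of large projected mass. The random sum conditioned to
  start with such a slope differs from it by at most \<open>K * \<gamma> ^ n\<close>, so by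
  \<open>proj_mass_perturb\<close> the mass at radius \<open>(1 + K) * \<gamma> ^ n\<close> is large
  almost surely.\<close>

lemma dyadic_mass_le_bernoulli:
  assumes x: "0 \<le> x" "x < 1"
  shows "(\<Sum>k<2 ^ n. indicator {s. ennreal t < s} (proj_mass (slope \<gamma> n k) x (\<gamma> ^ n))) \<le>
    2 ^ n * emeasure (bernoulli_convolution \<gamma>) {\<theta>. ennreal t < proj_mass \<theta> x ((1 + K) * \<gamma> ^ n)}"
proof -
  let ?A = "{\<theta>. ennreal t < proj_mass \<theta> x ((1 + K) * \<gamma> ^ n)}"
  have A [measurable]: "?A \<in> sets borel" by measurable
  have "indicator {s. ennreal t < s} (proj_mass (slope \<gamma> n k) x (\<gamma> ^ n)) \<le>
    emeasure (bernoulli_convolution \<gamma>) {\<theta>. slope \<gamma> n k + \<gamma> ^ n * \<theta> \<in> ?A}" for k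
  proof (cases "ennreal t < proj_mass (slope \<gamma> n k) x (\<gamma> ^ n)")
    case True
    have "slope \<gamma> n k + \<gamma> ^ n * \<theta> \<in> ?A" if "\<bar>\<theta>\<bar> \<le> K" for \<theta>
    proof -
      have "\<bar>slope \<gamma> n k - (slope \<gamma> n k + \<gamma> ^ n * \<theta>)\<bar> \<le> \<gamma> ^ n * K"
        using that \<gamma> by (simp add: abs_mult)
      from proj_mass_perturb[OF x this, of "\<gamma> ^ n"] True show ?thesis
        by (auto simp: algebra_simps intro: less_le_trans)
    qed
    then have "AE \<theta> in bernoulli_convolution \<gamma>. slope \<gamma> n k + \<gamma> ^ n * \<theta> \<in> ?A"
      using AE_bernoulli_convolution by (auto elim!: eventually_mono)
    then have "emeasure (bernoulli_convolution \<gamma>) UNIV =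
        emeasure (bernoulli_convolution \<gamma>) {\<theta>. slope \<gamma> n k + \<gamma> ^ n * \<theta> \<in> ?A}"
      by (intro emeasure_eq_AE) (auto elim!: eventually_mono)
    then show ?thesis using True by (simp add: emeasure_bernoulli_convolution_UNIV)
  qed simp
  then show ?thesis
    unfolding emeasure_bernoulli_convolution_slope[OF A] by (intro sum_mono)
qed

end

section \<open>Change of measure and the size of the exceptional sets\<close>

context takagi_L2
begin

text \<open>The square of the norm of \<open>f\<close>, not the norm itself.\<close>

definition L2 :: real where "L2 = (\<integral>x. (f x)\<^sup>2 \<partial>lborel)"

lemma L2_nonneg: "0 \<le> L2"
  by (simp add: L2_def)

text \<open>Pointwise \<open>f\<close> is at most \<open>c\<close> or at most f^2/c. The level
  \<open>c\<close> stays free and is later chosen to depend on \<open>n\<close>.\<close>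

lemma emeasure_bernoulli_le:
  assumes [measurable]: "A \<in> sets borel" and c: "0 < c"
  shows "emeasure (bernoulli_convolution \<gamma>) A \<le> ennreal c * emeasure lborel (A \<inter> {-K..K}) + ennreal (L2 / c)"
proof -
  have "emeasure (bernoulli_convolution \<gamma>) A = emeasure (bernoulli_convolution \<gamma>) (A \<inter> {-K..K})"
    using AE_bernoulli_convolution by (intro emeasure_eq_AE) (auto elim!: eventually_mono)
  also have "\<dots> = (\<integral>\<^sup>+\<theta>. ennreal (f \<theta>) * indicator (A \<inter> {-K..K}) \<theta> \<partial>lborel)"
    unfolding density by (rule emeasure_density) auto
  also have "\<dots> \<le> (\<integral>\<^sup>+\<theta>. ennreal c * indicator (A \<inter> {-K..K}) \<theta> + ennreal ((f \<theta>)\<^sup>2 / c) \<partial>lborel)"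
  proof (rule nn_integral_mono)
    fix \<theta>
    have "f \<theta> \<le> c + (f \<theta>)\<^sup>2 / c"
    proof -
      have "c * f \<theta> \<le> c * c + f \<theta> * f \<theta>"
      proof (cases "f \<theta> \<le> c")
        case True
        then show ?thesis using c by (smt (verit) mult_left_mono zero_le_square)
      next
        case False
        then show ?thesis using c by (smt (verit) mult_right_mono zero_le_square f_nonneg)
      qed
      then show ?thesis using c by (simp add: field_simps power2_eq_square)
    qed
    then have "ennreal (f \<theta>) \<le> ennreal (c + (f \<theta>)\<^sup>2 / c)"
      by (rule ennreal_leI)
    also have "\<dots> = ennreal c + ennreal ((f \<theta>)\<^sup>2 / c)"
      using c by (intro ennreal_plus) auto
    finally have "ennreal (f \<theta>) \<le> ennreal c + ennreal ((f \<theta>)\<^sup>2 / c)" .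
    then show "ennreal (f \<theta>) * indicator (A \<inter> {-K..K}) \<theta> \<le>
        ennreal c * indicator (A \<inter> {-K..K}) \<theta> + ennreal ((f \<theta>)\<^sup>2 / c)"
      by (auto simp: indicator_def)
  qed
  also have "\<dots> = ennreal c * emeasure lborel (A \<inter> {-K..K}) + (\<integral>\<^sup>+\<theta>. ennreal ((f \<theta>)\<^sup>2 / c) \<partial>lborel)"
    by (subst nn_integral_add) (auto simp: nn_integral_cmult_indicator)
  also have "(\<integral>\<^sup>+\<theta>. ennreal ((f \<theta>)\<^sup>2 / c) \<partial>lborel) = ennreal (L2 / c)"
    using square_integrable c by (subst nn_integral_eq_integral) (auto simp: L2_def)
  finally show ?thesis .
qed

lemma emeasure_concentration_le:
  assumes "0 \<le> x" "x < 1" "0 < r" "0 < t" "0 < c"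
  shows "emeasure (bernoulli_convolution \<gamma>) {\<theta>. ennreal t < proj_mass \<theta> x r}
    \<le> ennreal (c * (8 * r * ln ((r + K) / r)) / t + L2 / c)"
proof -
  let ?A = "{\<theta>. ennreal t < proj_mass \<theta> x r}"
  define b where "b = 8 * r * ln ((r + K) / r)"
  have b: "0 \<le> b"
    using assms K by (auto simp: b_def intro!: mult_nonneg_nonneg ln_ge_zero)
  have A [measurable]: "?A \<in> sets borel" by measurable
  \<comment> \<open>Markov's inequality for the projected mass under Lebesgue measure on the
    parameters.\<close>
  have "ennreal t * emeasure lborel (?A \<inter> {-K..K}) = (\<integral>\<^sup>+\<theta>. ennreal t * indicator (?A \<inter> {-K..K}) \<theta> \<partial>lborel)"
    by (simp add: nn_integral_cmult_indicator)
  also have "\<dots> \<le> (\<integral>\<^sup>+\<theta>. indicator {-K..K} \<theta> * proj_mass \<theta> x r \<partial>lborel)"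
    by (intro nn_integral_mono) (auto simp: indicator_def)
  also have "\<dots> \<le> ennreal b"
    unfolding b_def using assms by (intro nn_integral_proj_mass_le)
  finally have "ennreal (c / t) * (ennreal t * emeasure lborel (?A \<inter> {-K..K})) \<le> ennreal (c / t) * ennreal b"
    by (intro mult_left_mono) auto
  then have "ennreal c * emeasure lborel (?A \<inter> {-K..K}) \<le> ennreal (c * b / t)"
    using assms b by (simp add: mult.assoc[symmetric] ennreal_mult[symmetric])
  with emeasure_bernoulli_le[OF A \<open>0 < c\<close>]
  have "emeasure (bernoulli_convolution \<gamma>) ?A \<le> ennreal (c * b / t) + ennreal (L2 / c)"
    by (meson add_right_mono order_trans)
  then show ?thesis
    unfolding b_def[symmetric] using assms b L2_nonneg by (subst ennreal_plus) auto
qed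

text \<open>A uniform point is a uniform \<open>k\<close> together with an independent uniform
  position \<open>x\<close> in the unit interval. For fixed \<open>x\<close> the slopes are compared
  with the Bernoulli convolution, with a bound that does not depend on \<open>x\<close>.\<close>

lemma emeasure_bad_le:
  fixes n :: nat
  assumes "0 < \<tau>" "0 < c"
  defines "r \<equiv> (1 + K) * \<gamma> ^ n"
  shows "emeasure lborel (bad \<tau> n) \<le> ennreal (c * (8 * r * ln ((r + K) / r)) / \<tau> ^ n + L2 / c)"
proof -
  let ?e = "ennreal (c * (8 * r * ln ((r + K) / r)) / \<tau> ^ n + L2 / c)"
  let ?I = "\<lambda>k x. indicator {s. ennreal (\<tau> ^ n) < s} (proj_mass (slope \<gamma> n k) x (\<gamma> ^ n)) :: ennreal"
  have r: "0 < r" using K \<gamma> by (simp add: r_def)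
  have "emeasure lborel (bad \<tau> n) = (\<integral>\<^sup>+x. indicator (bad \<tau> n) x \<partial>lborel)"
    by simp
  also have "\<dots> = (\<integral>\<^sup>+x. indicator {0..<1} x * indicator (bad \<tau> n) x \<partial>lborel)"
    by (intro nn_integral_cong) (auto simp: bad_def indicator_def)
  also have "\<dots> = ennreal ((1 / 2) ^ n) *
      (\<Sum>k<2 ^ n. \<integral>\<^sup>+x. indicator {0..<1} x * indicator (bad \<tau> n) ((real k + x) / 2 ^ n) \<partial>lborel)"
    by (rule nn_integral_unit_dyadic) measurable
  also have "\<dots> \<le> ennreal ((1 / 2) ^ n) * (\<Sum>k<2 ^ n. \<integral>\<^sup>+x. indicator {0..<1} x * ?I k x \<partial>lborel)"
  proof (rule mult_left_mono[OF sum_mono[OF nn_integral_mono]])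
    fix k x assume "k \<in> {..<2 ^ n :: nat}"
    then have k: "k < 2 ^ n" by simp
    have "ennreal (\<tau> ^ n) < proj_mass (slope \<gamma> n k) x (\<gamma> ^ n)"
      if "(real k + x) / 2 ^ n \<in> bad \<tau> n" "0 \<le> x" "x < 1"
    proof (rule ccontr)
      assume "\<not> ?thesis"
      then have "ennreal ((1 / 2) ^ n) * proj_mass (slope \<gamma> n k) x (\<gamma> ^ n) \<le> ennreal ((1 / 2) ^ n) * ennreal (\<tau> ^ n)"
        by (intro mult_left_mono) auto
      also have "\<dots> = ennreal ((\<tau> / 2) ^ n)"
        using \<open>0 < \<tau>\<close> by (simp add: ennreal_mult[symmetric] power_divide)
      finally have "emeasure lborel (window n ((real k + x) / 2 ^ n)) \<le> ennreal ((\<tau> / 2) ^ n)"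
        unfolding emeasure_window_dyadic[OF k that(2,3)] .
      moreover have "ennreal ((\<tau> / 2) ^ n) < emeasure lborel (window n ((real k + x) / 2 ^ n))"
        using that(1) unfolding bad_def by blast
      ultimately show False by (simp add: leD)
    qed
    then show "indicator {0..<1} x * indicator (bad \<tau> n) ((real k + x) / 2 ^ n) \<le> indicator {0..<1} x * ?I k x"
      by (auto simp: indicator_def)
  qed auto
  also have "\<dots> = ennreal ((1 / 2) ^ n) * (\<integral>\<^sup>+x. indicator {0..<1} x * (\<Sum>k<2 ^ n. ?I k x) \<partial>lborel)"
  proof -
    have "(\<integral>\<^sup>+x. indicator {0..<1} x * (\<Sum>k<2 ^ n. ?I k x) \<partial>lborel)
        = (\<integral>\<^sup>+x. (\<Sum>k<2 ^ n. indicator {0..<1} x * ?I k x) \<partial>lborel)"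
      by (simp only: sum_distrib_left)
    also have "\<dots> = (\<Sum>k<2 ^ n. \<integral>\<^sup>+x. indicator {0..<1} x * ?I k x \<partial>lborel)"
    proof (rule nn_integral_sum)
      fix k
      have "{s. ennreal (\<tau> ^ n) < s} \<in> sets borel" by measurable
      moreover have "(\<lambda>x. proj_mass (slope \<gamma> n k) x (\<gamma> ^ n)) \<in> borel_measurable lborel"
        by (rule borel_measurable_proj_mass) auto
      ultimately have "(\<lambda>x. ?I k x) \<in> borel_measurable lborel"
        by (intro measurable_compose[OF _ borel_measurable_indicator])
      then show "(\<lambda>x. indicator {0..<1} x * ?I k x) \<in> borel_measurable lborel"
        by (intro borel_measurable_times_ennreal) auto
    qed
    finally show ?thesis by simp
  qed
  also have "\<dots> \<le> ennreal ((1 / 2) ^ n) * (\<integral>\<^sup>+x. indicator {0..<1} x * (2 ^ n * ?e) \<partial>(lborel :: real measure))"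
  proof (rule mult_left_mono[OF nn_integral_mono])
    fix x :: real
    have "(\<Sum>k<2 ^ n. ?I k x) \<le> 2 ^ n * ?e" if x: "0 \<le> x" "x < 1"
    proof -
      have "(\<Sum>k<2 ^ n. ?I k x) \<le> 2 ^ n * emeasure (bernoulli_convolution \<gamma>) {\<theta>. ennreal (\<tau> ^ n) < proj_mass \<theta> x r}"
        unfolding r_def by (rule dyadic_mass_le_bernoulli[OF x])
      also have "\<dots> \<le> 2 ^ n * ?e"
        using assms(1,2) by (intro mult_left_mono emeasure_concentration_le x r) auto
      finally show ?thesis .
    qed
    then show "indicator {0..<1} x * (\<Sum>k<2 ^ n. ?I k x) \<le> indicator {0..<1} x * (2 ^ n * ?e)"
      by (auto simp: indicator_def)
  qed auto
  also have "\<dots> = ennreal ((1 / 2) ^ n) * (2 ^ n * ?e)"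
    by (subst nn_integral_multc) auto
  also have "\<dots> = ?e"
  proof -
    have "ennreal ((1 / 2) ^ n) * 2 ^ n = ennreal ((1 / 2) ^ n * 2 ^ n)"
      using ennreal_power[of 2 n] by (subst ennreal_mult) simp_all
    also have "\<dots> = 1" by (simp add: power_mult_distrib[symmetric])
    finally show ?thesis by (simp add: mult.assoc[symmetric])
  qed
  finally show ?thesis .
qed

text \<open>The choice \<open>c = 1 / q ^ n\<close> balances the two terms: the first is of order
  \<open>n * q ^ n\<close> because \<open>q\<^sup>2 * \<tau> = \<gamma>\<close>, the second is
  \<open>L2 * q ^ n\<close>.\<close>

lemma summable_emeasure_bad:
  assumes "0 < \<tau>" "0 < q" "q < 1" "q\<^sup>2 * \<tau> = \<gamma>"
  obtains a where "summable a" "\<And>n. 0 \<le> a n" "\<And>n. emeasure lborel (bad \<tau> n) \<le> ennreal (a n)"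
proof
  \<comment> \<open>Chosen so that \<open>ln ((r + K) / r)\<close> is at most
    \<open>Suc n * L\<close> for \<open>r = (1 + K) * \<gamma> ^ n\<close>.\<close>
  define L where "L = ln ((1 + 2 * K) / (1 + K)) + ln (1 / \<gamma>)"
  define a where "a = (\<lambda>n. (8 * (1 + K) * L + L2) * (real (Suc n) * q ^ n))"
  have ln_nonneg: "0 \<le> ln ((1 + 2 * K) / (1 + K))" "0 \<le> ln (1 / \<gamma>)"
    using K(1) \<gamma>(1,2) by (auto intro!: ln_ge_zero)
  then have L: "0 \<le> L" by (simp add: L_def)
  show "0 \<le> a n" for n
    using L K(1) L2_nonneg assms by (auto simp: a_def intro!: mult_nonneg_nonneg add_nonneg_nonneg)
  have "summable (\<lambda>n. real (Suc n) * q ^ n)"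
    using geometric_deriv_sums[of q] assms by (auto simp: sums_iff)
  then show "summable a"
    unfolding a_def by (rule summable_mult)
  show "emeasure lborel (bad \<tau> n) \<le> ennreal (a n)" for n
  proof -
    define r where "r = (1 + K) * \<gamma> ^ n"
    have r: "0 < r" using K \<gamma> by (simp add: r_def)
    have "ln ((r + K) / r) \<le> ln ((1 + 2 * K) / (1 + K) * (1 / \<gamma>) ^ n)"
    proof (rule ln_mono)
      have "r \<le> 1 + K" using K(1) \<gamma>(1,2) by (simp add: r_def mult_left_le power_le_one)
      then have "(r + K) / r \<le> (1 + 2 * K) / r"
        using r by (intro divide_right_mono) auto
      then show "(r + K) / r \<le> (1 + 2 * K) / (1 + K) * (1 / \<gamma>) ^ n"
        by (simp add: r_def power_divide)
    qed (use r K in auto)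
    also have "\<dots> = ln ((1 + 2 * K) / (1 + K)) + real n * ln (1 / \<gamma>)"
      using K \<gamma> by (subst ln_mult) (auto simp: ln_realpow)
    also have "\<dots> \<le> real (Suc n) * L"
      using ln_nonneg by (simp add: L_def algebra_simps)
    finally have ln_le: "ln ((r + K) / r) \<le> real (Suc n) * L" .
    have eq: "\<gamma> ^ n / (q ^ n * \<tau> ^ n) = q ^ n"
      using assms by (simp flip: assms(4) add: power_mult_distrib power2_eq_square)
    have "1 / q ^ n * (8 * r * (real (Suc n) * L)) / \<tau> ^ n
        = 8 * (1 + K) * L * (real (Suc n) * (\<gamma> ^ n / (q ^ n * \<tau> ^ n)))"
      unfolding r_def by (simp only: times_divide_eq_left times_divide_eq_right mult_1 divide_divide_eq_left mult_ac)
    then have "1 / q ^ n * (8 * r * (real (Suc n) * L)) / \<tau> ^ n = 8 * (1 + K) * L * (real (Suc n) * q ^ n)"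
      unfolding eq .
    moreover have "1 / q ^ n * (8 * r * ln ((r + K) / r)) / \<tau> ^ n \<le> 1 / q ^ n * (8 * r * (real (Suc n) * L)) / \<tau> ^ n"
      using r assms ln_le by (intro divide_right_mono mult_left_mono) auto
    moreover have "L2 / (1 / q ^ n) \<le> L2 * (real (Suc n) * q ^ n)"
      using L2_nonneg assms by (simp add: mult_left_mono distrib_right)
    ultimately have "1 / q ^ n * (8 * r * ln ((r + K) / r)) / \<tau> ^ n + L2 / (1 / q ^ n) \<le> a n"
      unfolding a_def by (simp only: distrib_right)
    then show ?thesis
      using emeasure_bad_le[of \<tau> "1 / q ^ n" n] assms(1,2) unfolding r_def[symmetric]
      by (meson ennreal_leI order_trans zero_less_divide_1_iff zero_less_power)
  qed
qed

end

section \<open>Mass distribution on the graph\<close>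

context takagi
begin

definition D :: real where "D = 2 + ln lam / ln 2"

text \<open>\<open>4 * lam\<close> is the growth factor per level of the number of dyadic squares in
  the covering of the graph: 2 for the columns times \<open>2 * lam\<close> for the squares in a
  column.\<close>

lemma two_powr_D: "2 powr D = 4 * lam"
proof -
  have "2 powr (ln lam / ln 2) = lam" using lam by (simp add: powr_def)
  then show ?thesis by (simp add: D_def powr_add)
qed

definition graph :: "(real \<times> real) set" where "graph = {(x, w x) | x. x \<in> {0..<1}}"

text \<open>
  A set \<open>U\<close> of diameter comparable to \<open>2\<^sup>-\<^sup>n\<close> meets the graph above at most three dyadic intervals of
  length \<open>2\<^sup>-\<^sup>n\<close>, and above each of them it stays in \<open>window n x\<close> for any \<open>x\<close> in its projection.
\<close>

lemma cover_piece_le_gauge: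
  assumes s: "0 \<le> s" and \<tau>: "\<tau> = 2 powr (1 - s)"
    and E: "E \<subseteq> {0..<1}" "\<And>n x. m \<le> n \<Longrightarrow> x \<in> E \<Longrightarrow> x \<notin> bad \<tau> n"
    and U: "bounded U" "diameter U \<le> (1 / 2) ^ m"
  obtains V where "V \<in> sets borel" "{x \<in> E. (x, w x) \<in> U} \<subseteq> V"
    "emeasure lborel V \<le> ennreal (3 * 2 powr s) * hausdorff_gauge s U"
proof -
  let ?S = "{x \<in> E. (x, w x) \<in> U}"
  have close: "\<bar>x - y\<bar> \<le> diameter U" "\<bar>w x - w y\<bar> \<le> diameter U" if "x \<in> ?S" "y \<in> ?S" for x y
  proof -
    have "dist (x, w x) (y, w y) \<le> diameter U"
      using that by (intro diameter_bounded_bound U) auto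
    then show "\<bar>x - y\<bar> \<le> diameter U" "\<bar>w x - w y\<bar> \<le> diameter U"
      using dist_fst_le[of "(x, w x)" "(y, w y)"] dist_snd_le[of "(x, w x)" "(y, w y)"]
      by (auto simp: dist_real_def)
  qed
  \<comment> \<open>For \<open>s = 0\<close> the gauge is 1 and the whole unit interval serves as
    \<open>V\<close>; for positive \<open>s\<close> and diameter 0 the gauge is 0 and
    \<open>V\<close> is a null singleton.\<close>
  consider "?S = {}" | x0 where "x0 \<in> ?S" "s = 0" | x0 where "x0 \<in> ?S" "s \<noteq> 0" "diameter U = 0"
    | x0 where "x0 \<in> ?S" "s \<noteq> 0" "0 < diameter U"
    using diameter_ge_0[OF U(1)] by fastforce
  then show thesis
  proof cases
    case 1
    then show thesis by (intro that[of "{}"]) auto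
  next
    case 2
    then have "hausdorff_gauge s U = 1" by (auto simp: hausdorff_gauge_def)
    then show thesis
      using E 2 by (intro that[of "{0..<1}"]) (auto simp: ennreal_numeral[symmetric] simp del: ennreal_numeral)
  next
    case 3
    then have "?S \<subseteq> {x0}" using close(1)[of _ x0] by force
    then show thesis by (intro that[of "{x0}"]) auto
  next
    case 4
    define d where "d = diameter U"
    \<comment> \<open>The level of \<open>U\<close>: one less than the first j with 2^-j below the
      diameter. It is at least \<open>m\<close> by the bound on the diameter.\<close>
    obtain n where n: "m \<le> n" "(1 / 2) ^ Suc n < d" "d \<le> (1 / 2) ^ n"
    proof -
      define j where "j = (LEAST j. (1 / 2) ^ j < d)"
      obtain j0 where "(1 / 2) ^ j0 < d"
        using real_arch_pow_inv[of d "1 / 2"] 4 by (auto simp: d_def)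
      then have j: "(1 / 2) ^ j < d" unfolding j_def by (rule LeastI)
      have "m < j"
      proof (rule ccontr)
        assume "\<not> m < j"
        then have "(1 / 2) ^ m \<le> ((1 / 2) ^ j :: real)" by (intro power_decreasing) auto
        then show False using j U(2) unfolding d_def by linarith
      qed
      moreover have "d \<le> (1 / 2) ^ (j - 1)"
        using not_less_Least[of "j - 1" "\<lambda>j. (1 / 2) ^ j < d"] \<open>m < j\<close> by (fastforce simp: j_def[symmetric])
      ultimately show thesis using j by (intro that[of "j - 1"]) auto
    qed
    define c :: "real \<Rightarrow> int" where "c = (\<lambda>x. \<lfloor>2 ^ n * x\<rfloor>)"
    define J where "J = c ` ?S"
    have J: "J \<subseteq> {c x0 - 1, c x0, c x0 + 1}"
    proof
      fix i assume "i \<in> J"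
      then obtain x where x: "x \<in> ?S" "i = c x" by (auto simp: J_def)
      have "\<bar>x - x0\<bar> \<le> (1 / 2) ^ n"
        using close(1)[OF x(1) 4(1)] n by (simp add: d_def)
      then have "2 ^ n * \<bar>x - x0\<bar> \<le> 1" by (simp add: field_simps)
      then have "\<bar>2 ^ n * x - 2 ^ n * x0\<bar> \<le> 1"
        by (simp add: abs_mult right_diff_distrib[symmetric])
      then have "\<bar>c x - c x0\<bar> \<le> 1" unfolding c_def by linarith
      then show "i \<in> {c x0 - 1, c x0, c x0 + 1}" using x by auto
    qed
    then have "finite J" by (rule finite_subset) simp
    have "card J \<le> card {c x0 - 1, c x0, c x0 + 1}" using J by (intro card_mono) auto
    also have "\<dots> \<le> 3" by (simp add: card_insert_if)
    finally have "card J \<le> 3" .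
    \<comment> \<open>A representative of \<open>E\<close> in each dyadic interval that is met. It
      avoids \<open>bad \<tau> n\<close>, so its window is small, and that window contains
      everything of \<open>?S\<close> in the interval.\<close>
    define P where "P = (\<lambda>i. SOME x. x \<in> ?S \<and> c x = i)"
    have P: "P i \<in> ?S" "c (P i) = i" if "i \<in> J" for i
      using someI_ex[of "\<lambda>x. x \<in> ?S \<and> c x = i"] that by (auto simp: P_def J_def)
    define V where "V = (\<Union>i\<in>J. window n (P i))"
    have "?S \<subseteq> V"
    proof
      fix x assume x: "x \<in> ?S"
      then have i: "c x \<in> J" by (auto simp: J_def)
      have "\<bar>w (P (c x)) - w x\<bar> \<le> (1 / 2) ^ n"
        using close(2)[OF P(1)[OF i] x] n by (simp add: d_def)
      moreover have "\<lfloor>2 ^ n * x\<rfloor> = \<lfloor>2 ^ n * P (c x)\<rfloor>"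
        using P(2)[OF i] by (simp add: c_def)
      ultimately have "x \<in> window n (P (c x))"
        using x E(1) by (auto simp: window_def)
      then show "x \<in> V" using i by (auto simp: V_def)
    qed
    have window_le: "emeasure lborel (window n (P i)) \<le> ennreal ((\<tau> / 2) ^ n)" if "i \<in> J" for i
      using E(2)[OF n(1), of "P i"] P(1)[OF that] E(1) by (auto simp: bad_def not_less)
    have "emeasure lborel V \<le> (\<Sum>i\<in>J. emeasure lborel (window n (P i)))"
      unfolding V_def using \<open>finite J\<close> by (intro emeasure_subadditive_finite) auto
    also have "\<dots> \<le> (\<Sum>i\<in>J. ennreal ((\<tau> / 2) ^ n))"
      by (intro sum_mono window_le)
    also have "\<dots> = ennreal (real (card J) * (\<tau> / 2) ^ n)"
      using \<tau> by (simp add: ennreal_mult ennreal_of_nat_eq_real_of_nat)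
    also have "\<dots> \<le> ennreal (3 * 2 powr s * d powr s)"
    proof (intro ennreal_leI)
      \<comment> \<open>The diameter may be almost half of 2^-n; \<open>2 powr s\<close> pays for
        this.\<close>
      have "2 powr s * ((1 / 2) ^ Suc n) powr s = (\<tau> / 2) ^ n"
      proof -
        have "\<tau> / 2 = (1 / 2) powr s" using \<tau> by (simp add: powr_diff powr_divide)
        then have "(\<tau> / 2) ^ n = ((1 / 2) ^ n) powr s"
          by (simp add: powr_powr powr_realpow[symmetric] mult.commute)
        then show ?thesis by (simp add: powr_mult powr_divide)
      qed
      then have "(\<tau> / 2) ^ n \<le> 2 powr s * d powr s"
        using n(2) s by (metis less_imp_le mult_left_mono powr_ge_zero powr_mono2 zero_le_divide_1_iff zero_le_numeral zero_le_power)
      then show "real (card J) * (\<tau> / 2) ^ n \<le> 3 * 2 powr s * d powr s"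
        using \<open>card J \<le> 3\<close> \<tau> unfolding mult.assoc by (intro mult_mono) auto
    qed
    also have "\<dots> = ennreal (3 * 2 powr s) * hausdorff_gauge s U"
      using 4 by (auto simp: hausdorff_gauge_def d_def ennreal_mult)
    finally show thesis
      using \<open>?S \<subseteq> V\<close> \<open>finite J\<close> by (intro that[of V]) (auto simp: V_def)
  qed
qed

end

context takagi_L2
begin

text \<open>Outside the exceptional sets of all levels from \<open>m\<close> on there remains a set
  \<open>E\<close> of positive measure. Each piece of a fine cover carries at most a constant times
  its gauge of this measure, which bounds the gauge sum from below.\<close>

lemma hausdorff_measure_graph_pos:
  assumes s: "0 \<le> s" "s < D"
  shows "hausdorff_measure s graph \<noteq> 0"
proof
  assume zero: "hausdorff_measure s graph = 0"
  define \<tau> where "\<tau> = 2 powr (1 - s)"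
  \<comment> \<open>As \<gamma> is 2^(1-D), this is the solution of
    \<open>q\<^sup>2 * \<tau> = \<gamma>\<close>; it is below 1 because
    \<open>s < D\<close>.\<close>
  define q where "q = 2 powr (- (D - s) / 2)"
  have "q\<^sup>2 * \<tau> = 2 powr (1 - D)"
    by (simp add: q_def \<tau>_def power2_eq_square powr_add[symmetric])
  also have "\<dots> = \<gamma>"
    using two_powr_D by (simp add: powr_diff \<gamma>_eq)
  finally have q: "q\<^sup>2 * \<tau> = \<gamma>" .
  have "q < 1" using s powr_less_mono[of "- (D - s) / 2" 0 2] by (simp add: q_def)
  obtain a where a: "summable a" "\<And>n. 0 \<le> a n" "\<And>n. emeasure lborel (bad \<tau> n) \<le> ennreal (a n)"
  proof (rule summable_emeasure_bad[OF _ _ \<open>q < 1\<close> q])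
    show "0 < \<tau>" "0 < q" by (simp_all add: \<tau>_def q_def)
  qed blast
  obtain m where "norm (\<Sum>i. a (i + m)) < 1"
    using suminf_exist_split[OF zero_less_one a(1)] by blast
  then have m: "(\<Sum>i. a (i + m)) < 1" by simp
  define B where "B = (\<Union>i. bad \<tau> (i + m))"
  define E where "E = {0..<1} - B"
  have [measurable]: "B \<in> sets borel" "E \<in> sets borel"
    by (auto simp: B_def E_def)
  have am: "summable (\<lambda>i. a (i + m))" using a(1) by (subst summable_iff_shift)
  have "emeasure lborel B \<le> (\<Sum>i. emeasure lborel (bad \<tau> (i + m)))"
    unfolding B_def by (rule emeasure_subadditive_countably) auto
  also have "\<dots> \<le> (\<Sum>i. ennreal (a (i + m)))"
    by (intro suminf_le a) auto
  also have "\<dots> = ennreal (\<Sum>i. a (i + m))"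
    using a am by (intro suminf_ennreal2) auto
  also have "\<dots> < 1" using m by simp
  finally have B: "emeasure lborel B < 1" .
  have "1 = emeasure lborel {0..<1 :: real}" by simp
  also have "\<dots> \<le> emeasure lborel (E \<union> B)"
    by (intro emeasure_mono) (auto simp: E_def)
  also have "\<dots> \<le> emeasure lborel E + emeasure lborel B"
    by (intro emeasure_subadditive) auto
  finally have "emeasure lborel E \<noteq> 0" using B by (auto simp: not_less)
  have "emeasure lborel E \<le> emeasure lborel {0..<1 :: real}"
    by (intro emeasure_mono) (auto simp: E_def)
  then have "emeasure lborel E \<noteq> \<infinity>" by (auto simp: top_unique)
  then obtain e where e: "emeasure lborel E = ennreal e" "0 \<le> e"
    by (cases "emeasure lborel E") auto
  with \<open>emeasure lborel E \<noteq> 0\<close> have "0 < e" by (cases "e = 0") auto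
  define C where "C = 3 * 2 powr s"
  have C: "0 < C" by (simp add: C_def)
  have "hausdorff_premeasure s ((1 / 2) ^ m) graph \<le> hausdorff_measure s graph"
    unfolding hausdorff_measure_def by (intro SUP_upper) simp
  \<comment> \<open>A cover with gauge sum below this value would give \<open>E\<close> measure at
    most \<open>e / 2\<close>.\<close>
  also have "\<dots> < ennreal (e / (2 * C))" using zero C \<open>0 < e\<close> by simp
  finally obtain U where U: "(\<Sum>i. hausdorff_gauge s (U i)) < ennreal (e / (2 * C))"
      "graph \<subseteq> (\<Union>i. U i)" "\<And>i. bounded (U i)" "\<And>i. diameter (U i) \<le> (1 / 2) ^ m"
    unfolding hausdorff_premeasure_def Inf_less_iff by auto
  have E_good: "x \<notin> bad \<tau> n" if "m \<le> n" "x \<in> E" for n x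
  proof -
    have "x \<notin> bad \<tau> ((n - m) + m)" using that(2) unfolding E_def B_def by blast
    then show ?thesis using that(1) by simp
  qed
  have "\<exists>V. V \<in> sets borel \<and> {x \<in> E. (x, w x) \<in> U i} \<subseteq> V \<and>
      emeasure lborel V \<le> ennreal C * hausdorff_gauge s (U i)" for i
  proof (rule cover_piece_le_gauge[OF s(1) \<tau>_def])
    show "E \<subseteq> {0..<1}" by (auto simp: E_def)
    show "bounded (U i)" "diameter (U i) \<le> (1 / 2) ^ m" by (rule U)+
  qed (use E_good C_def in blast)+
  from choice[OF allI[OF this]] obtain V
    where "\<forall>i. V i \<in> sets borel \<and> {x \<in> E. (x, w x) \<in> U i} \<subseteq> V i \<and>
      emeasure lborel (V i) \<le> ennreal C * hausdorff_gauge s (U i)" ..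
  then have V: "V i \<in> sets borel" "{x \<in> E. (x, w x) \<in> U i} \<subseteq> V i"
      "emeasure lborel (V i) \<le> ennreal C * hausdorff_gauge s (U i)" for i
    by simp_all
  have "E \<subseteq> (\<Union>i. V i)"
  proof
    fix x assume x: "x \<in> E"
    then have "(x, w x) \<in> graph" by (auto simp: graph_def E_def)
    then obtain i where "(x, w x) \<in> U i" using U(2) by auto
    then show "x \<in> (\<Union>i. V i)" using V(2)[of i] x by auto
  qed
  then have "ennreal e \<le> emeasure lborel (\<Union>i. V i)"
    unfolding e(1)[symmetric] using V(1) by (intro emeasure_mono) auto
  also have "\<dots> \<le> (\<Sum>i. emeasure lborel (V i))"
    using V(1) by (intro emeasure_subadditive_countably) auto
  also have "\<dots> \<le> (\<Sum>i. ennreal C * hausdorff_gauge s (U i))"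
    by (intro suminf_le V) auto
  also have "\<dots> = ennreal C * (\<Sum>i. hausdorff_gauge s (U i))"
    by simp
  also have "\<dots> \<le> ennreal C * ennreal (e / (2 * C))"
    using U(1) by (intro mult_left_mono) auto
  also have "\<dots> = ennreal (e / 2)"
    using C e by (subst ennreal_mult[symmetric]) auto
  finally show False using \<open>0 < e\<close> by (simp add: ennreal_le_iff)
qed

end

context takagi
begin

subsection \<open>Upper bound\<close>

text \<open>Over the interval \<open>w\<close> is a copy of \<open>h\<close> scaled by
  \<open>lam ^ n\<close>, whose oscillation comes from the range of \<open>w\<close> and the bounded
  slope.\<close>

lemma oscillation_le:
  assumes "0 \<le> x" "x < 1" "0 \<le> y" "y < 1"
  shows "\<bar>w ((real k + x) / 2 ^ n) - w ((real k + y) / 2 ^ n)\<bar> \<le> lam ^ n * (1 / (1 - lam) + K)"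
proof -
  let ?\<theta> = "slope \<gamma> n k"
  have "\<bar>w x - w y\<bar> \<le> 1 / (1 - lam)"
    using w_bounds[of x] w_bounds[of y] by linarith
  moreover have "\<bar>?\<theta>\<bar> * \<bar>x - y\<bar> \<le> K * 1"
    using assms abs_slope_le[of n k] K(1) by (intro mult_mono) auto
  moreover have "h ?\<theta> x - h ?\<theta> y = (w x - w y) + ?\<theta> * (x - y)"
    by (simp add: h_def algebra_simps)
  ultimately have "\<bar>h ?\<theta> x - h ?\<theta> y\<bar> \<le> 1 / (1 - lam) + K"
    by (simp add: abs_mult[symmetric])
  then show ?thesis
    using lam by (simp add: w_diff_dyadic[OF assms] abs_mult)
qed

text \<open>The graph is covered by squares of side 2^-n in 2^n columns of \<open>m\<close> squares
  each. A column has height at least \<open>R * lam ^ n\<close>, which takes about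
  \<open>R * (2 * lam) ^ n\<close> squares.\<close>

lemma hausdorff_premeasure_graph_le:
  assumes "0 < s" "2 * (1 / 2) ^ n \<le> \<delta>"
  defines "R \<equiv> 2 * (1 / (1 - lam) + K)"
  shows "hausdorff_premeasure s \<delta> graph \<le> ennreal ((R + 1) * (2 powr s * (4 * lam * 2 powr - s) ^ n))"
proof -
  \<comment> \<open>The bottom of column \<open>k\<close>: the graph may fall below its value at the
    left endpoint by the oscillation bound and rise by as much, hence the factor 2 in
    \<open>R\<close>.\<close>
  define c where "c = (\<lambda>k. w (real k / 2 ^ n) - lam ^ n * (1 / (1 - lam) + K))"
  define m where "m = Suc (nat \<lfloor>R * (2 * lam) ^ n\<rfloor>)"
  define box where "box = (\<lambda>k j. {real k / 2 ^ n .. (real k + 1) / 2 ^ n} \<times>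
    {c k + real j / 2 ^ n .. c k + (real j + 1) / 2 ^ n})"
  \<comment> \<open>The pairs of column and row are numbered by \<open>k * m + j\<close>; the
    remaining sets are empty and have gauge 0.\<close>
  define U where "U = (\<lambda>i. if i < 2 ^ n * m then box (i div m) (i mod m) else {})"
  have R: "0 \<le> R" using lam K(1) by (simp add: R_def)
  have m: "0 < m" "real m \<le> (R + 1) * (2 * lam) ^ n"
  proof -
    \<comment> \<open>This absorbs the extra square that rounding costs in each column.\<close>
    have "1 \<le> (2 * lam) ^ n" using lam by (intro one_le_power) auto
    moreover have "real m \<le> R * (2 * lam) ^ n + 1"
      using R lam by (simp add: m_def)
    ultimately show "real m \<le> (R + 1) * (2 * lam) ^ n" by (simp add: distrib_right)
  qed (simp add: m_def)
  have box_dist: "dist p p' \<le> 2 * (1 / 2) ^ n" if "p \<in> box k j" "p' \<in> box k j" for p p' k j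
  proof -
    obtain x y x' y' where p: "p = (x, y)" "p' = (x', y')" by (cases p, cases p') auto
    have "\<bar>x - x'\<bar> \<le> (real k + 1) / 2 ^ n - real k / 2 ^ n"
      "\<bar>y - y'\<bar> \<le> (real j + 1) / 2 ^ n - real j / 2 ^ n"
      using that by (auto simp: box_def p)
    then have "\<bar>x - x'\<bar> + \<bar>y - y'\<bar> \<le> 2 * (1 / 2) ^ n"
      by (simp add: diff_divide_distrib[symmetric] power_divide)
    then show ?thesis
      using sqrt_sum_squares_le_sum_abs[of "x - x'" "y - y'"] by (simp add: p dist_Pair_Pair dist_real_def)
  qed
  have U_bounded: "bounded (U i)" for i
    by (auto simp: U_def box_def intro!: bounded_Times)
  have U_diameter: "diameter (U i) \<le> 2 * (1 / 2) ^ n" for i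
    by (rule diameter_le) (auto simp: U_def dist_norm[symmetric] split: if_split_asm intro: box_dist)
  have cover: "graph \<subseteq> (\<Union>i. U i)"
  proof
    fix p assume "p \<in> graph"
    then obtain x where x: "p = (x, w x)" "0 \<le> x" "x < 1" by (auto simp: graph_def)
    define k where "k = nat \<lfloor>2 ^ n * x\<rfloor>"
    have k: "real k \<le> 2 ^ n * x" "2 ^ n * x < real k + 1"
      using x by (simp_all add: k_def)
    have "real k < 2 ^ n"
    proof -
      have "2 ^ n * x < 2 ^ n" using x by simp
      then show ?thesis using k by linarith
    qed
    then have "k < 2 ^ n" by (metis of_nat_less_iff of_nat_numeral of_nat_power)
    have "w x = w ((real k + (2 ^ n * x - real k)) / 2 ^ n)" by simp
    then have "\<bar>w x - w (real k / 2 ^ n)\<bar> \<le> lam ^ n * (1 / (1 - lam) + K)"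
      using oscillation_le[of "2 ^ n * x - real k" 0 k n] k by simp
    moreover have "lam ^ n * R = 2 * (lam ^ n * (1 / (1 - lam) + K))"
      by (simp add: R_def)
    ultimately have wx: "0 \<le> w x - c k" "w x - c k \<le> lam ^ n * R"
      unfolding c_def by linarith+
    define j where "j = nat \<lfloor>2 ^ n * (w x - c k)\<rfloor>"
    have j: "real j \<le> 2 ^ n * (w x - c k)" "2 ^ n * (w x - c k) < real j + 1"
      using wx by (simp_all add: j_def)
    have "2 ^ n * (w x - c k) \<le> R * (2 * lam) ^ n"
      using wx(2) mult_left_mono[OF wx(2), of "2 ^ n"] by (simp add: power_mult_distrib mult_ac)
    then have "j < m" unfolding j_def m_def by (simp add: floor_mono le_imp_less_Suc nat_mono)
    define i where "i = k * m + j"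
    have "i < Suc k * m" using \<open>j < m\<close> by (simp add: i_def)
    also have "\<dots> \<le> 2 ^ n * m" using \<open>k < 2 ^ n\<close> by (intro mult_right_mono) auto
    finally have "i < 2 ^ n * m" .
    moreover have "i div m = k" "i mod m = j"
      using \<open>j < m\<close> by (simp_all add: i_def)
    moreover have "p \<in> box k j"
      using j k by (simp add: x box_def field_simps)
    ultimately show "p \<in> (\<Union>i. U i)" by (auto simp: U_def)
  qed
  have "hausdorff_premeasure s \<delta> graph \<le> (\<Sum>i. hausdorff_gauge s (U i))"
    unfolding hausdorff_premeasure_def
  proof (rule Inf_lower, intro CollectI exI[of _ U] conjI allI refl)
    show "graph \<subseteq> (\<Union>i. U i)" by (rule cover)
    show "bounded (U i)" "diameter (U i) \<le> \<delta>" for i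
      using U_bounded U_diameter[of i] assms(2) by simp_all
  qed
  also have "\<dots> = (\<Sum>i<2 ^ n * m. hausdorff_gauge s (U i))"
    by (intro suminf_finite) (auto simp: U_def hausdorff_gauge_def)
  also have "\<dots> \<le> (\<Sum>i<2 ^ n * m. ennreal ((2 * (1 / 2) ^ n) powr s))"
    using \<open>0 < s\<close> U_diameter diameter_ge_0[OF U_bounded]
    by (intro sum_mono) (auto simp: hausdorff_gauge_def intro!: ennreal_leI powr_mono2)
  also have "\<dots> = ennreal (real (2 ^ n * m) * (2 * (1 / 2) ^ n) powr s)"
    by (simp add: ennreal_mult ennreal_of_nat_eq_real_of_nat del: of_nat_mult)
  also have "\<dots> \<le> ennreal ((R + 1) * (2 powr s * (4 * lam * 2 powr - s) ^ n))"
  proof (intro ennreal_leI)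
    have eq: "(2 * (1 / 2) ^ n) powr s = 2 powr s * (2 powr - s) ^ n"
    proof -
      have "((1 / 2) ^ n) powr s = ((1 / 2) powr s) ^ n"
        by (simp add: powr_powr powr_realpow[symmetric] mult.commute)
      then show ?thesis by (simp add: powr_mult powr_divide powr_minus_divide)
    qed
    have "real (2 ^ n * m) \<le> 2 ^ n * ((R + 1) * (2 * lam) ^ n)"
      using m by simp
    then have "real (2 ^ n * m) * (2 * (1 / 2) ^ n) powr s \<le>
        2 ^ n * ((R + 1) * (2 * lam) ^ n) * (2 powr s * (2 powr - s) ^ n)"
      unfolding eq by (intro mult_right_mono) auto
    also have "\<dots> = (R + 1) * (2 powr s * ((2 ^ n * (2 * lam) ^ n) * (2 powr - s) ^ n))"
      by (simp only: mult_ac)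
    also have "(2 ^ n * (2 * lam) ^ n) * (2 powr - s) ^ n = (4 * lam * 2 powr - s) ^ n"
      by (simp only: power_mult_distrib[symmetric]) simp
    finally show "real (2 ^ n * m) * (2 * (1 / 2) ^ n) powr s \<le> (R + 1) * (2 powr s * (4 * lam * 2 powr - s) ^ n)" .
  qed
  finally show ?thesis .
qed

lemma D_pos: "0 < D"
proof -
  have "ln (1 / 2) < ln lam" using lam by (intro ln_less_cancel_iff[THEN iffD2]) auto
  then have "- 1 < ln lam / ln 2" by (simp add: ln_div field_simps)
  then show ?thesis by (simp add: D_def)
qed

text \<open>The square covers of level n bound the premeasure by a constant times the n-th power of
  2^(D-s), and this tends to 0.\<close>

lemma hausdorff_measure_graph_eq_0:
  assumes "D < s"
  shows "hausdorff_measure s graph = 0"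
proof -
  define \<rho> where "\<rho> = 4 * lam * 2 powr - s"
  have "\<rho> = 2 powr (D - s)"
    by (simp add: \<rho>_def two_powr_D[symmetric] powr_add[symmetric])
  then have \<rho>: "0 < \<rho>" "\<rho> < 1"
    using assms powr_less_mono[of "D - s" 0 2] by simp_all
  have "hausdorff_premeasure s \<delta> graph = 0" if "0 < \<delta>" for \<delta>
  proof -
    define C where "C = 2 * (1 / (1 - lam) + K) + 1"
    have "(\<lambda>n. ennreal (C * (2 powr s * \<rho> ^ n))) \<longlonglongrightarrow> ennreal (C * (2 powr s * 0))"
      using \<rho> by (intro tendsto_ennrealI tendsto_intros LIMSEQ_realpow_zero) auto
    moreover have "\<forall>\<^sub>F n in sequentially. hausdorff_premeasure s \<delta> graph \<le> ennreal (C * (2 powr s * \<rho> ^ n))"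
    proof -
      have "(\<lambda>n. 2 * (1 / 2 :: real) ^ n) \<longlonglongrightarrow> 2 * 0"
        by (intro tendsto_intros LIMSEQ_realpow_zero) auto
      then have "\<forall>\<^sub>F n in sequentially. 2 * (1 / 2 :: real) ^ n < \<delta>"
        using that by (intro order_tendstoD(2)) auto
      then show ?thesis
      proof (rule eventually_mono)
        fix n :: nat assume "2 * (1 / 2) ^ n < \<delta>"
        then show "hausdorff_premeasure s \<delta> graph \<le> ennreal (C * (2 powr s * \<rho> ^ n))"
          using hausdorff_premeasure_graph_le[of s n \<delta>] assms D_pos by (simp add: \<rho>_def C_def)
      qed
    qed
    ultimately have "hausdorff_premeasure s \<delta> graph \<le> ennreal (C * (2 powr s * 0))"
      by (rule tendsto_lowerbound) simp
    then show ?thesis by simp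
  qed
  then have "hausdorff_measure s graph = (SUP \<delta>\<in>{0::real<..}. 0)"
    unfolding hausdorff_measure_def by (intro SUP_cong) auto
  then show ?thesis by simp
qed

end

text \<open>Every exponent above \<open>D\<close> is admissible in the infimum and none below; the
  measure at \<open>D\<close> itself is not evaluated.\<close>

lemma (in takagi_L2) hausdorff_dim_graph: "hausdorff_dim graph = ereal D"
proof (rule antisym)
  show "hausdorff_dim graph \<le> ereal D"
  proof (rule ereal_le_epsilon2)
    fix e :: real assume "0 < e"
    then show "hausdorff_dim graph \<le> ereal D + ereal e"
      unfolding hausdorff_dim_def using D_pos hausdorff_measure_graph_eq_0[of "D + e"]
      by (intro Inf_lower) auto
  qed
  show "ereal D \<le> hausdorff_dim graph"
    unfolding hausdorff_dim_def
  proof (rule Inf_greatest)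
    fix z assume "z \<in> {ereal s | s. 0 \<le> s \<and> hausdorff_measure s graph = 0}"
    then obtain s where "z = ereal s" "0 \<le> s" "hausdorff_measure s graph = 0" by auto
    then show "ereal D \<le> z" using hausdorff_measure_graph_pos[of s] by (cases "s < D") auto
  qed
qed

theorem theorem2p1:
  fixes lam \<gamma> :: real
  assumes "0 < lam" and "lam < 1" and "2 * lam > 1"
    and "\<gamma> = 1 / (2 * lam)"
    and "has_square_integrable_density (bernoulli_convolution \<gamma>)"
  shows "hausdorff_dim {(x, W lam 2 x) | x. x \<in> {0..<1}} = ereal (2 + ln lam / ln 2)"
proof -
  interpret takagi lam \<gamma> by unfold_locales (use assms in auto)
  obtain f where "takagi_L2 lam \<gamma> f"
    using assms(5) unfolding has_square_integrable_density_def takagi_L2_def takagi_L2_axioms_def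
    by (auto intro: takagi_axioms)
  from takagi_L2.hausdorff_dim_graph[OF this] show ?thesis
    by (simp only: graph_def D_def)
qed

end
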